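(* Let $g(s)=\frac{1}{1+G(s)}$ be the sensitivity function of a linear feedback system with open-loop (forward path) transfer function $G$. Suppose $g$ is non-analytic in the open right half plane, its zeros in the open right half plane are $\alpha_1,\dots,\alpha_M$, and its poles in the open right half plane are $\beta_1,\dots,\beta_N$. Let $$\widetilde g(s)=g(s)\prod_{1\le i\le M}\left(\frac{s+\overline{\alpha}_i}{s-\alpha_i}\right)\prod_{1\le i\le N}\left(\frac{s-\beta_i}{s+\overline{\beta}_i}\right)$$ be the modified sensitivity function, which is analytic in the open right half plane, and let $\widetilde G$ be the open-loop transfer function associated with $\widetilde g$, i.e. $\widetilde g=\frac{1}{1+\widetilde G}$. Let $\omega_c>0$ and suppose $$\rho=\max_{0\le\omega\le\omega_c}|\widetilde g(j\omega)|\in[0,1),\qquad s_{\max}=\max_{\omega>\omega_c}|\widetilde g(j\omega)|\in[1,\infty).$$ (a) If $\sigma_k>0$ is a real point with $-\log|\widetilde g(\sigma_k)|<0$, then $$\log s_{\max}\ \ge\ \frac{\left|\frac{\pi}{2}\log|\widetilde g(\sigma_k)|-\tan^{-1}\frac{\omega_c}{\sigma_k}\,\log\rho\right|}{\frac{\pi}{2}-\tan^{-1}\frac{\omega_c}{\sigma_k}}.$$ (b) If $\sigma_k=\varsigma_k>0$ is a real zero of $\widetilde G$ in the open right half plane, then $$\log s_{\max}\ \ge\ \frac{\left|\tan^{-1}\frac{\omega_c}{\sigma_k}\,\log\rho\right|}{\frac{\pi}{2}-\tan^{-1}\frac{\omega_c}{\sigma_k}}.$$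
   Context: Here $j$ is the imaginary unit, $\log$ of a positive real is the natural logarithm, and the open right half plane (RHP) is $\{s\in\mathbb{C}:\operatorname{Re}s>0\}$. The linear feedback system is a unity feedback loop with plant transfer function $G_p(s)$, controller transfer function $G_c(s)$ and open-loop (forward path) transfer function $G(s)=G_c(s)G_p(s)$. Transfer functions of the plant and controller are quotients of polynomials with real coefficients, possibly multiplied by a dead-time factor: $G(s)=\frac{Q(s)}{P(s)}e^{-t_d s}$ with real polynomials $P,Q$, $P\not\equiv0$, and $t_d\ge 0$; no restriction is placed on the relative degree. It is assumed that $1+G\not\equiv 0$, and $g=1/(1+G)$ is regarded as a meromorphic function on $\mathbb{C}$. The lists $\alpha_1,\dots,\alpha_M$ and $\beta_1,\dots,\beta_N$ are finite and complete lists of the RHP zeros and RHP poles of $g$, repeated according to multiplicity. Products and quotients such as $\widetilde g$ are taken as meromorphic functions, with removable singularities removed. With $\kappa(s)=\prod_{1\le i\le M}\frac{s+\overline{\alpha}_i}{s-\alpha_i}\prod_{1\le i\le N}\frac{s-\beta_i}{s+\overline{\beta}_i}$ one has $\widetilde g=\kappa g$ and $\widetilde G=\frac{1-\kappa+G}{\kappa}$. *)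

theory Defs
  imports "HOL-Complex_Analysis.Complex_Analysis"
begin

definition open_rhp :: "complex set" where
  "open_rhp = {s. Re s > 0}"

text \<open>
  Transfer functions with dead time: \<open>Q(s)/P(s) \<cdot> exp(-t\<^sub>d s)\<close> with real polynomials \<open>P\<close>, \<open>Q\<close>.
  At the zeros of \<open>P\<close> the HOL value is \<open>0\<close>; such points only ever enter below through
  punctured neighbourhoods, because every function derived from it is passed through
  \<open>remove_sings\<close>.
\<close>

definition dead_time_tf :: "real poly \<Rightarrow> real poly \<Rightarrow> real \<Rightarrow> complex \<Rightarrow> complex" where
  "dead_time_tf Q P t\<^sub>d s =
     poly (map_poly of_real Q) s / poly (map_poly of_real P) s * exp (- (of_real t\<^sub>d * s))"

definition sensitivity :: "(complex \<Rightarrow> complex) \<Rightarrow> complex \<Rightarrow> complex" where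
  "sensitivity G = remove_sings (\<lambda>s. 1 / (1 + G s))"

text \<open>
  Complete lists of the zeros and of the poles of a meromorphic function in a set, each point
  being repeated according to its multiplicity (\<open>zorder\<close> is negative at poles).
\<close>

definition is_zero_list :: "(complex \<Rightarrow> complex) \<Rightarrow> complex set \<Rightarrow> complex list \<Rightarrow> bool" where
  "is_zero_list f A zs \<longleftrightarrow>
     (\<forall>z. int (count_list zs z) = (if z \<in> A \<and> isolated_zero f z then zorder f z else 0))"

definition is_pole_list :: "(complex \<Rightarrow> complex) \<Rightarrow> complex set \<Rightarrow> complex list \<Rightarrow> bool" where
  "is_pole_list f A zs \<longleftrightarrow>
     (\<forall>z. int (count_list zs z) = (if z \<in> A \<and> is_pole f z then - zorder f z else 0))"

definition kappa :: "complex list \<Rightarrow> complex list \<Rightarrow> complex \<Rightarrow> complex" where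
  "kappa \<alpha>s \<beta>s s = (\<Prod>i<length \<alpha>s. (s + cnj (\<alpha>s ! i)) / (s - \<alpha>s ! i)) *
                   (\<Prod>i<length \<beta>s. (s - \<beta>s ! i) / (s + cnj (\<beta>s ! i)))"

definition modified_sensitivity ::
  "(complex \<Rightarrow> complex) \<Rightarrow> complex list \<Rightarrow> complex list \<Rightarrow> complex \<Rightarrow> complex" where
  "modified_sensitivity G \<alpha>s \<beta>s = remove_sings (\<lambda>s. sensitivity G s * kappa \<alpha>s \<beta>s s)"

text \<open>
  The open-loop transfer function belonging to the modified sensitivity function, i.e.\ the
  solution \<open>H\<close> of \<open>\<kappa> / (1 + G) = 1 / (1 + H)\<close>.
\<close>

definition modified_open_loop ::
  "(complex \<Rightarrow> complex) \<Rightarrow> complex list \<Rightarrow> complex list \<Rightarrow> complex \<Rightarrow> complex" where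
  "modified_open_loop G \<alpha>s \<beta>s =
     remove_sings (\<lambda>s. (1 - kappa \<alpha>s \<beta>s s + G s) / kappa \<alpha>s \<beta>s s)"

text \<open>
  \<open>m\<close> is the attained maximum of \<open>f\<close> on \<open>S\<close>.  For the modulus of a meromorphic function along
  the imaginary axis, a real maximum on an interval excludes poles there: \<open>remove_sings\<close>
  assigns \<open>0\<close> to a pole, but the modulus is unbounded in any neighbourhood of it.
\<close>

definition is_max_on :: "real \<Rightarrow> ('a \<Rightarrow> real) \<Rightarrow> 'a set \<Rightarrow> bool" where
  "is_max_on m f S \<longleftrightarrow> m \<in> f ` S \<and> (\<forall>x\<in>S. f x \<le> m)"

end

(*
  On the axis the Blaschke factor kappa has modulus 1, and log |g'| is bounded there by log rho on
  the segment [-i w, i w] and by log s_max elsewhere. Since g' is zero-free in the right half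
  plane, comparing log |g'| with the harmonic function that has exactly these boundary values
  (it is affine in the angle 2 arctan(w / sigma) under which the segment is seen) gives
    (pi/2) log |g'(sigma)| <= arctan(w/sigma) log rho + (pi/2 - arctan(w/sigma)) log s_max.
  For part (b), a zero of G' is a point where g' = 1.

  The comparison needs growth control of g' at infinity, which is not among the hypotheses. It
  comes from the finiteness of the zero and pole lists: up to a zero-free factor of polynomial
  growth, g' is the reciprocal of a bounded zero-free function, so Harnack's inequality bounds
  |g'(s)| by exp(C |s+1|^2 / Re s). Phragmen-Lindelof arguments on half discs, quadrants and the
  half plane improve this successively to exponential type, polynomial growth and boundedness.
*)
theory Submission
  imports Defs "HOL-Real_Asymp.Real_Asymp" "HOL-Computational_Algebra.Fundamental_Theorem_Algebra"
begin

section \<open>Phragmen-Lindelof principles\<close>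

text \<open>An axis bound alone cannot suffice: exp(s) is zero-free, has modulus 1 on the axis and
  is unbounded in the half plane. Such a factor is excluded on the positive real axis, where |P + Q
  exp(-t_d s)| eventually stays away from 0, so that the modified sensitivity grows at most
  polynomially there. Off the real axis no lower bound for this denominator is at hand, only a
  polynomial upper bound, from |exp(-t_d s)| <= 1; this is why Harnack's inequality is applied to
  the reciprocal. The kernel |s+1|^2 / Re s equals 4 / (1 - |w|^2) for the Cayley image w =
  (s-1)/(s+1). It blows up at the axis, hence at the two ends of the arc of a half disc. The
  hypotheses speak of nonnegative frequencies only; real coefficients carry them to the whole axis.
  Values of quotients at zeros of their denominators are conventional, so the exceptional points are
  reached by limits or by relations cleared of denominators.\<close>

lemma maximum_modulus_limsup:
  assumes U: "open U" and hol: "f holomorphic_on U"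
    and bd: "\<And>\<xi> \<epsilon>. \<xi> \<in> frontier U \<Longrightarrow> \<epsilon> > 0 \<Longrightarrow> \<forall>\<^sub>F s in at \<xi> within U. cmod (f s) \<le> M + \<epsilon>"
    and inf: "\<And>\<epsilon>. \<epsilon> > 0 \<Longrightarrow> \<forall>\<^sub>F s in at_infinity. s \<in> U \<longrightarrow> cmod (f s) \<le> M + \<epsilon>"
    and z: "z \<in> U"
  shows "cmod (f z) \<le> M"
proof (rule field_le_epsilon)
  fix \<epsilon> :: real assume \<epsilon>: "\<epsilon> > 0"
  \<comment> \<open>This superlevel set is bounded by \<open>inf\<close>, and its closure stays
    inside \<open>U\<close> by \<open>bd\<close>. Hence |f| <= M + \<epsilon> on its frontier, and
    the ordinary maximum principle on a bounded set shows that it is empty.\<close>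
  define V where "V = {s\<in>U. cmod (f s) > M + \<epsilon>}"
  have cont: "continuous_on U f"
    by (rule holomorphic_on_imp_continuous_on[OF hol])
  have "V = U \<inter> (\<lambda>s. cmod (f s)) -` {M + \<epsilon><..}"
    by (auto simp: V_def)
  then have oV: "open V"
    using continuous_open_preimage[of U "\<lambda>s. cmod (f s)" "{M + \<epsilon><..}"] U cont
    by (auto intro: continuous_on_norm)
  obtain R where R: "\<And>s. cmod s \<ge> R \<Longrightarrow> s \<in> U \<Longrightarrow> cmod (f s) \<le> M + \<epsilon>"
    using inf[OF \<epsilon>] by (auto simp: eventually_at_infinity)
  have bV: "bounded V"
    unfolding bounded_iff V_def using R by (force intro!: exI[of _ R])
  have clV: "closure V \<subseteq> U"
  proof
    fix \<xi> assume \<xi>: "\<xi> \<in> closure V"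
    show "\<xi> \<in> U"
    proof (rule ccontr)
      assume nU: "\<xi> \<notin> U"
      then have nV: "\<xi> \<notin> V"
        by (auto simp: V_def)
      have "\<xi> \<in> closure U"
        using \<xi> closure_mono[of V U] by (auto simp: V_def)
      then have "\<xi> \<in> frontier U"
        using nU U by (simp add: frontier_def interior_open)
      then have "\<forall>\<^sub>F s in at \<xi> within U. cmod (f s) \<le> M + \<epsilon>"
        using bd \<epsilon> by blast
      then have "\<forall>\<^sub>F s in at \<xi> within V. cmod (f s) \<le> M + \<epsilon>"
        by (rule filter_leD[OF at_le, rotated]) (auto simp: V_def)
      moreover have "\<forall>\<^sub>F s in at \<xi> within V. s \<in> V"
        by (auto simp: eventually_at_filter)
      ultimately have "\<forall>\<^sub>F s in at \<xi> within V. False"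
        by eventually_elim (auto simp: V_def)
      \<comment> \<open>\<open>\<xi>\<close> lies in the closure of \<open>V\<close> but not in
        \<open>V\<close>, so it is a limit point.\<close>
      moreover have "at \<xi> within V \<noteq> bot"
        using \<xi> nV by (metis closure_def UnE mem_Collect_eq trivial_limit_within)
      ultimately show False
        by (simp add: eventually_False)
    qed
  qed
  show "cmod (f z) \<le> M + \<epsilon>"
  proof (rule ccontr)
    assume "\<not> ?thesis"
    then have zV: "z \<in> V"
      using z by (simp add: V_def)
    have "cmod (f z) \<le> M + \<epsilon>"
    proof (rule maximum_modulus_frontier[of f V _ z])
      show "f holomorphic_on interior V"
        using hol by (rule holomorphic_on_subset) (use interior_subset in \<open>auto simp: V_def\<close>)
      show "continuous_on (closure V) f"
        using cont clV by (rule continuous_on_subset)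
      show "cmod (f w) \<le> M + \<epsilon>" if "w \<in> frontier V" for w
        using that clV oV by (auto simp: frontier_def interior_open V_def)
    qed (use zV bV in auto)
    with zV show False
      by (simp add: V_def)
  qed
qed

text \<open>The power (exp(-i \<phi>) s)^a, written through \<open>Ln\<close>, has argument at most
  a \<delta> < pi/2 in modulus, so its real part is comparable to |s|^a. It is the exponent of the
  damping factor in the sector principle.\<close>

lemma Re_exp_Ln_sector_ge:
  assumes "a > 0" "a * \<delta> < pi / 2" "s \<noteq> 0" "\<bar>Im (Ln s) - \<phi>\<bar> \<le> \<delta>"
  shows "Re (exp (of_real a * (Ln s - \<i> * of_real \<phi>))) \<ge> cos (a * \<delta>) * cmod s powr a"
proof -
  have le: "\<bar>a * (Im (Ln s) - \<phi>)\<bar> \<le> a * \<delta>"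
    using assms by (simp add: abs_mult)
  have "cos (a * \<delta>) \<le> cos \<bar>a * (Im (Ln s) - \<phi>)\<bar>"
    using assms le pi_gt_zero by (intro cos_monotone_0_pi_le) auto
  then have "cos (a * \<delta>) \<le> cos (a * (Im (Ln s) - \<phi>))"
    by simp
  moreover have "Re (exp (of_real a * (Ln s - \<i> * of_real \<phi>))) =
      cmod s powr a * cos (a * (Im (Ln s) - \<phi>))"
    using assms by (simp add: Re_exp powr_def algebra_simps)
  ultimately show ?thesis
    by (metis mult.commute mult_left_mono powr_ge_zero)
qed

text \<open>For w = (exp(-i \<phi>) s)^a the factor exp(-\<eta> w) has modulus at most 1 on
  \<open>U\<close>, so it respects the boundary bounds, and it beats exp(C |s|^b) at infinity
  because b < a. Finally \<eta> tends to 0.\<close>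

lemma Phragmen_Lindelof_sector:
  fixes f :: "complex \<Rightarrow> complex"
  assumes U: "open U" and hol: "f holomorphic_on U"
    and sect: "\<And>s. s \<in> U \<Longrightarrow> s \<notin> \<real>\<^sub>\<le>\<^sub>0 \<and> \<bar>Im (Ln s) - \<phi>\<bar> \<le> \<delta>"
    and a: "0 < a" "a * \<delta> < pi / 2" and b: "0 < b" "b < a"
    and bd: "\<And>\<xi> \<epsilon>. \<xi> \<in> frontier U \<Longrightarrow> \<epsilon> > 0 \<Longrightarrow> \<forall>\<^sub>F s in at \<xi> within U. cmod (f s) \<le> M + \<epsilon>"
    and M: "M \<ge> 0"
    and growth: "\<And>s. s \<in> U \<Longrightarrow> cmod (f s) \<le> K * exp (C * cmod s powr b)"
    and z: "z \<in> U"
  shows "cmod (f z) \<le> M"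
proof -
  define w where "w = (\<lambda>s. exp (of_real a * (Ln s - \<i> * of_real \<phi>)))"
  define c where "c = cos (a * \<delta>)"
  have nz: "s \<noteq> 0" if "s \<in> U" for s
    using sect[OF that] by auto
  have d: "\<delta> \<ge> 0"
    using sect[OF z] by linarith
  have c: "c > 0"
    unfolding c_def using a d by (intro cos_gt_zero_pi) (auto intro: less_le_trans[of _ 0])
  have w: "Re (w s) \<ge> c * cmod s powr a" if "s \<in> U" for s
    unfolding w_def c_def using sect[OF that] nz[OF that] a by (intro Re_exp_Ln_sector_ge) auto
  have w0: "Re (w s) \<ge> 0" if "s \<in> U" for s
    using w[OF that] c by (meson dual_order.trans mult_nonneg_nonneg less_imp_le powr_ge_zero)
  have main: "cmod (f z * exp (- of_real \<eta> * w z)) \<le> M" if \<eta>: "\<eta> > 0" for \<eta> :: real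
  proof (rule maximum_modulus_limsup[OF U, where f = "\<lambda>s. f s * exp (- of_real \<eta> * w s)"])
    show "(\<lambda>s. f s * exp (- of_real \<eta> * w s)) holomorphic_on U"
      unfolding w_def using sect by (intro holomorphic_intros hol) auto
    have small: "cmod (f s * exp (- of_real \<eta> * w s)) \<le> cmod (f s)" if "s \<in> U" for s
      using w0[OF that] \<eta> by (auto simp: norm_mult intro!: mult_left_le)
    show "\<forall>\<^sub>F s in at \<xi> within U. cmod (f s * exp (- of_real \<eta> * w s)) \<le> M + \<epsilon>"
      if "\<xi> \<in> frontier U" "\<epsilon> > 0" for \<xi> \<epsilon>
    proof -
      have "\<forall>\<^sub>F s in at \<xi> within U. s \<in> U"
        by (auto simp: eventually_at_filter)
      with bd[OF that] show ?thesis
        by eventually_elim (use small order_trans in blast)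
    qed
    show "\<forall>\<^sub>F s in at_infinity. s \<in> U \<longrightarrow> cmod (f s * exp (- of_real \<eta> * w s)) \<le> M + \<epsilon>"
      if \<epsilon>: "\<epsilon> > 0" for \<epsilon>
    proof -
      have "\<forall>\<^sub>F r::real in at_top. \<bar>K\<bar> * exp (C * r powr b - \<eta> * (c * r powr a)) < \<epsilon>"
      proof (rule order_tendstoD)
        have "((\<lambda>r::real. \<bar>K\<bar> * exp (C * r powr b - \<eta> * (c * r powr a))) \<longlongrightarrow> \<bar>K\<bar> * 0) at_top"
        proof (intro tendsto_mult tendsto_const filterlim_compose[OF exp_at_bot])
          have "0 < \<eta> * c" using \<eta> c by simp
          moreover have "a - b > 0" using b by simp
          ultimately have "filterlim (\<lambda>r::real. r powr b * (C - (\<eta> * c) * r powr (a - b))) at_bot at_top"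
            using b by real_asymp
          then show "filterlim (\<lambda>r::real. C * r powr b - \<eta> * (c * r powr a)) at_bot at_top"
            by (rule filterlim_mono_eventually[OF _ order_refl order_refl])
               (auto intro!: eventually_mono[OF eventually_gt_at_top[of 0]]
                     simp: algebra_simps simp flip: powr_add)
        qed
        then show "((\<lambda>r::real. \<bar>K\<bar> * exp (C * r powr b - \<eta> * (c * r powr a))) \<longlongrightarrow> 0) at_top"
          by simp
      qed (use \<epsilon> in auto)
      then have "\<forall>\<^sub>F s::complex in at_infinity.
          \<bar>K\<bar> * exp (C * cmod s powr b - \<eta> * (c * cmod s powr a)) < \<epsilon>"
        by (rule eventually_compose_filterlim) (rule filterlim_norm_at_top)
      then show ?thesis
      proof (eventually_elim, intro impI)
        fix s assume s: "\<bar>K\<bar> * exp (C * cmod s powr b - \<eta> * (c * cmod s powr a)) < \<epsilon>" "s \<in> U"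
        have "cmod (f s * exp (- of_real \<eta> * w s)) = cmod (f s) * exp (- \<eta> * Re (w s))"
          by (simp add: norm_mult)
        also have "\<dots> \<le> (\<bar>K\<bar> * exp (C * cmod s powr b)) * exp (- (\<eta> * (c * cmod s powr a)))"
        proof (rule mult_mono)
          have "cmod (f s) \<le> K * exp (C * cmod s powr b)"
            using growth s by blast
          also have "\<dots> \<le> \<bar>K\<bar> * exp (C * cmod s powr b)"
            by (intro mult_right_mono) auto
          finally show "cmod (f s) \<le> \<bar>K\<bar> * exp (C * cmod s powr b)" .
          show "exp (- \<eta> * Re (w s)) \<le> exp (- (\<eta> * (c * cmod s powr a)))"
            using w[OF s(2)] \<eta> by simp
        qed auto
        also have "\<dots> = \<bar>K\<bar> * exp (C * cmod s powr b - \<eta> * (c * cmod s powr a))"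
          by (simp flip: exp_add)
        finally show "cmod (f s * exp (- of_real \<eta> * w s)) \<le> M + \<epsilon>"
          using s M by linarith
      qed
    qed
  qed (use z in auto)
  have "((\<lambda>\<eta>. cmod (f z * exp (- of_real \<eta> * w z))) \<longlongrightarrow> cmod (f z * exp (- of_real 0 * w z))) (at_right 0)"
    by (intro tendsto_intros)
  then have lim: "((\<lambda>\<eta>. cmod (f z * exp (- of_real \<eta> * w z))) \<longlongrightarrow> cmod (f z)) (at_right 0)"
    by simp
  show ?thesis
    by (rule tendsto_upperbound[OF lim])
       (use main in \<open>auto intro!: eventually_mono[OF eventually_at_right_less[of 0]]\<close>)
qed

section \<open>From half discs and quadrants to the right half plane\<close>

lemma open_open_rhp: "open open_rhp"
  by (simp add: open_rhp_def open_halfspace_Re_gt)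

lemma frontier_open_rhp: "\<xi> \<in> frontier open_rhp \<Longrightarrow> Re \<xi> = 0"
proof -
  assume \<xi>: "\<xi> \<in> frontier open_rhp"
  have "closure open_rhp \<subseteq> {s. Re s \<ge> 0}"
    by (rule closure_minimal) (auto simp: open_rhp_def closed_halfspace_Re_ge)
  with \<xi> open_open_rhp show ?thesis
    by (auto simp: frontier_def interior_open open_rhp_def)
qed

text \<open>With x = Re s, y = Im s and v = r - y or v = r + y, the two real parts are (x + v) /
  (x^2 + v^2), nonnegative in the half disc. On the arc x^2 = (r - y)(r + y), so the smaller v
  satisfies v^2 <= x^2, and its term alone is at least 1 / (2x).\<close>

lemma half_disc_barrier:
  fixes s :: complex
  assumes "Re s > 0" "cmod s \<le> r"
  shows "Re ((1 - \<i>) / (s - \<i> * of_real r) + (1 + \<i>) / (s + \<i> * of_real r)) \<ge> 0"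
    and "cmod s = r \<Longrightarrow>
      Re ((1 - \<i>) / (s - \<i> * of_real r) + (1 + \<i>) / (s + \<i> * of_real r)) \<ge> 1 / (2 * Re s)"
proof -
  define x y where "x = Re s" and "y = Im s"
  have x: "x > 0" and xy: "x\<^sup>2 + y\<^sup>2 \<le> r\<^sup>2"
    using assms by (auto simp: x_def y_def cmod_power2 [symmetric] power_mono)
  have r: "r > 0"
    using assms by (smt (verit) complex_Re_le_cmod)
  have "\<bar>y\<bar> \<le> r"
    using assms abs_Im_le_cmod[of s] by (simp add: y_def)
  then have y: "y \<le> r" "-r \<le> y" by auto
  have e1: "Re ((1 - \<i>) / (s - \<i> * of_real r)) = (x + (r - y)) / (x\<^sup>2 + (r - y)\<^sup>2)"
    by (simp add: Re_divide x_def y_def power2_commute)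
  have e2: "Re ((1 + \<i>) / (s + \<i> * of_real r)) = (x + (r + y)) / (x\<^sup>2 + (r + y)\<^sup>2)"
    by (simp add: Re_divide x_def y_def algebra_simps)
  have p1: "(x + (r - y)) / (x\<^sup>2 + (r - y)\<^sup>2) \<ge> 0" and p2: "(x + (r + y)) / (x\<^sup>2 + (r + y)\<^sup>2) \<ge> 0"
    using x y by simp_all
  show "Re ((1 - \<i>) / (s - \<i> * of_real r) + (1 + \<i>) / (s + \<i> * of_real r)) \<ge> 0"
    using e1 e2 p1 p2 by simp
  assume "cmod s = r"
  then have eq: "x\<^sup>2 = (r - y) * (r + y)"
    using cmod_power2[of s] by (simp add: x_def y_def algebra_simps power2_eq_square)
  have key: "1 / (2 * x) \<le> (x + v) / (x\<^sup>2 + v\<^sup>2)" if "0 \<le> v" "v\<^sup>2 \<le> x\<^sup>2" for v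
  proof -
    have "x\<^sup>2 + v\<^sup>2 \<le> (x + v) * (2 * x)"
    proof -
      have "0 \<le> v * (x * 2)" using that x by simp
      with that show ?thesis by (simp add: algebra_simps power2_eq_square)
    qed
    then show ?thesis
      using x by (simp add: divide_simps sum_power2_gt_zero_iff)
  qed
  show "Re ((1 - \<i>) / (s - \<i> * of_real r) + (1 + \<i>) / (s + \<i> * of_real r)) \<ge> 1 / (2 * Re s)"
  proof (cases "y \<ge> 0")
    case True
    then have "(r - y)\<^sup>2 \<le> x\<^sup>2"
      unfolding eq unfolding power2_eq_square using y by (intro mult_left_mono) auto
    from key[OF _ this] y show ?thesis
      using e1 e2 p2 by (simp add: x_def)
  next
    case False
    then have "(r + y)\<^sup>2 \<le> x\<^sup>2"
      unfolding eq unfolding power2_eq_square using y by (intro mult_right_mono) auto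
    from key[OF _ this] y show ?thesis
      using e1 e2 p1 by (simp add: x_def)
  qed
qed

lemma eventually_norm_le_limit:
  fixes f :: "'a::topological_space \<Rightarrow> 'b::real_normed_vector"
  assumes "continuous_on S f" "U \<subseteq> S" "\<xi> \<in> S" "norm (f \<xi>) \<le> M" "\<epsilon> > 0"
  shows "\<forall>\<^sub>F s in at \<xi> within U. norm (f s) \<le> M + \<epsilon>"
proof -
  have "(f \<longlongrightarrow> f \<xi>) (at \<xi> within U)"
    using assms continuous_on_def tendsto_within_subset by blast
  then have "((\<lambda>s. norm (f s)) \<longlongrightarrow> norm (f \<xi>)) (at \<xi> within U)"
    by (rule tendsto_norm)
  then have "\<forall>\<^sub>F s in at \<xi> within U. norm (f s) < M + \<epsilon>"
    by (rule order_tendstoD) (use assms in auto)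
  then show ?thesis
    by eventually_elim simp
qed

text \<open>
  The barrier \<open>half_disc_barrier\<close> absorbs the singularity of the growth bound at the two
  corners of the half disc.
\<close>

lemma exponential_type_half_plane:
  fixes f :: "complex \<Rightarrow> complex"
  assumes hol: "f holomorphic_on open_rhp" and cont: "continuous_on {s. Re s \<ge> 0} f"
    and axis: "\<And>s. Re s = 0 \<Longrightarrow> cmod (f s) \<le> M"
    and growth: "\<And>s. Re s > 0 \<Longrightarrow> cmod (f s) \<le> K * exp (C * (cmod (s + 1))\<^sup>2 / Re s)"
    and "C \<ge> 0" "K \<ge> 0"
  shows "\<exists>N D. \<forall>s. Re s > 0 \<longrightarrow> cmod (f s) \<le> N * exp (D * cmod s)"
proof -
  define L where "L = max M K"
  have "cmod (f z) \<le> L * exp (64 * C) * exp (128 * C * cmod z)" if z: "Re z > 0" for z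
  proof -
    \<comment> \<open>The radius is proportional to |z| and keeps z at distance at least r/2 from
      both corners, so Re (T z) <= 8/r and the barrier costs only d * 8/r = 64 C r, which is linear
      in |z|.\<close>
    define r where "r = 2 * cmod z + 1"
    define T where "T = (\<lambda>s. (1 - \<i>) / (s - \<i> * of_real r) + (1 + \<i>) / (s + \<i> * of_real r))"
    \<comment> \<open>On the arc |s + 1| <= 2r, so the growth exponent is at most 4 C r^2 / Re s = d
      / (2 Re s), just what d times the barrier absorbs.\<close>
    define d where "d = 8 * C * r\<^sup>2"
    define U where "U = open_rhp \<inter> ball 0 r"
    have r: "r \<ge> 1" and d: "d \<ge> 0"
      using \<open>C \<ge> 0\<close> by (auto simp: r_def d_def)
    have U: "open U"
      by (auto simp: U_def open_open_rhp)
    have T0: "Re (T s) \<ge> 0" if "Re s > 0" "cmod s \<le> r" for s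
      unfolding T_def using half_disc_barrier(1)[OF that] .
    have nz: "s - \<i> * of_real r \<noteq> 0" "s + \<i> * of_real r \<noteq> 0" if "Re s > 0" for s
      using that by (auto simp: complex_eq_iff)
    have holfT: "(\<lambda>s. f s * exp (- of_real d * T s)) holomorphic_on open_rhp"
      unfolding T_def using nz by (intro holomorphic_intros hol) (auto simp: open_rhp_def)
    have small: "cmod (f s * exp (- of_real d * T s)) \<le> cmod (f s)" if "Re s > 0" "cmod s \<le> r" for s
      using T0[OF that] d by (auto simp: norm_mult intro!: mult_left_le)
    have "cmod (f z * exp (- of_real d * T z)) \<le> L"
    proof (rule maximum_modulus_limsup[OF U, where f = "\<lambda>s. f s * exp (- of_real d * T s)"])
      show "(\<lambda>s. f s * exp (- of_real d * T s)) holomorphic_on U"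
        using holfT by (rule holomorphic_on_subset) (auto simp: U_def)
      show "\<forall>\<^sub>F s in at_infinity. s \<in> U \<longrightarrow> cmod (f s * exp (- of_real d * T s)) \<le> L + \<epsilon>" for \<epsilon>
        by (auto simp: eventually_at_infinity U_def intro!: exI[of _ r])
      show "z \<in> U"
        using z norm_ge_zero[of z] by (simp add: U_def open_rhp_def r_def del: norm_ge_zero)
      fix \<xi> and \<epsilon> :: real assume \<xi>: "\<xi> \<in> frontier U" and \<epsilon>: "\<epsilon> > 0"
      have "closure U \<subseteq> {s. Re s \<ge> 0} \<inter> cball 0 r"
        by (rule closure_minimal)
           (auto simp: U_def open_rhp_def closed_halfspace_Re_ge)
      with \<xi> U have cl: "Re \<xi> \<ge> 0" "cmod \<xi> \<le> r" "\<xi> \<notin> U"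
        by (auto simp: frontier_def interior_open)
      show "\<forall>\<^sub>F s in at \<xi> within U. cmod (f s * exp (- of_real d * T s)) \<le> L + \<epsilon>"
      proof (cases "Re \<xi> = 0")
        case True
        have "\<forall>\<^sub>F s in at \<xi> within U. cmod (f s) \<le> L + \<epsilon>"
          using axis[OF True] True \<epsilon>
          by (intro eventually_norm_le_limit[OF cont]) (auto simp: U_def open_rhp_def L_def)
        moreover have "\<forall>\<^sub>F s in at \<xi> within U. s \<in> U"
          by (auto simp: eventually_at_filter)
        ultimately show ?thesis
        proof eventually_elim
          case (elim s)
          then show ?case
            using small[of s] by (simp add: U_def open_rhp_def)
        qed
      next
        case False
        then have \<xi>': "Re \<xi> > 0" "cmod \<xi> = r"
          using cl by (auto simp: U_def open_rhp_def)
        have le: "cmod (\<xi> + 1) \<le> 2 * r"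
          using norm_triangle_ineq[of \<xi> 1] \<xi>' r by simp
        have "C * (cmod (\<xi> + 1))\<^sup>2 / Re \<xi> \<le> C * (2 * r)\<^sup>2 / Re \<xi>"
          using \<xi>' \<open>C \<ge> 0\<close> le by (intro divide_right_mono mult_left_mono power_mono) auto
        also have "\<dots> = d * (1 / (2 * Re \<xi>))"
          by (simp add: d_def)
        also have "\<dots> \<le> d * Re (T \<xi>)"
          unfolding T_def using d half_disc_barrier(2)[of \<xi> r] \<xi>' by (intro mult_left_mono) auto
        finally have "C * (cmod (\<xi> + 1))\<^sup>2 / Re \<xi> - d * Re (T \<xi>) \<le> 0"
          by simp
        then have "exp (C * (cmod (\<xi> + 1))\<^sup>2 / Re \<xi> - d * Re (T \<xi>)) \<le> 1"
          by simp
        then have "exp (C * (cmod (\<xi> + 1))\<^sup>2 / Re \<xi>) * exp (- d * Re (T \<xi>)) \<le> 1"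
          by (simp flip: exp_add)
        then have "K * (exp (C * (cmod (\<xi> + 1))\<^sup>2 / Re \<xi>) * exp (- d * Re (T \<xi>))) \<le> K"
          using \<open>K \<ge> 0\<close> by (intro mult_left_le) auto
        moreover have "cmod (f \<xi> * exp (- of_real d * T \<xi>)) \<le>
            K * exp (C * (cmod (\<xi> + 1))\<^sup>2 / Re \<xi>) * exp (- d * Re (T \<xi>))"
          using growth[OF \<xi>'(1)] by (simp add: norm_mult)
        ultimately have "cmod (f \<xi> * exp (- of_real d * T \<xi>)) \<le> L"
          by (simp add: L_def mult.assoc)
        then show ?thesis
          using \<xi>' \<epsilon>
          by (intro eventually_norm_le_limit[OF holomorphic_on_imp_continuous_on[OF holfT]])
             (auto simp: U_def open_rhp_def)
      qed
    qed
    then have fz: "cmod (f z) * exp (- d * Re (T z)) \<le> L"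
      by (simp add: norm_mult)
    have i2: "cmod (1 - \<i>) \<le> 2" "cmod (1 + \<i>) \<le> 2"
      using norm_triangle_ineq4[of 1 \<i>] norm_triangle_ineq[of 1 \<i>] by auto
    have norm_r: "cmod (\<i> * of_real r) = r" and rz: "r = 2 * cmod z + 1"
      using r by (simp add: norm_mult) (simp add: r_def)
    have far: "cmod (z - \<i> * of_real r) \<ge> r / 2" "cmod (z + \<i> * of_real r) \<ge> r / 2"
      using norm_triangle_ineq2[of "\<i> * of_real r" z] norm_triangle_ineq2[of "\<i> * of_real r" "-z"]
        norm_r rz by (simp_all add: norm_minus_commute add.commute)
    have "Re (T z) \<le> cmod (T z)"
      by (rule complex_Re_le_cmod)
    also have "\<dots> \<le> cmod ((1 - \<i>) / (z - \<i> * of_real r)) + cmod ((1 + \<i>) / (z + \<i> * of_real r))"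
      unfolding T_def by (rule norm_triangle_ineq)
    also have "\<dots> \<le> 2 / (r / 2) + 2 / (r / 2)"
      unfolding norm_divide using i2 far r by (intro add_mono frac_le) auto
    finally have "d * Re (T z) \<le> d * (8 / r)"
      using d by (intro mult_left_mono) auto
    also have "\<dots> = 64 * C * r"
      using r by (simp add: d_def power2_eq_square)
    finally have dT: "d * Re (T z) \<le> 64 * C * r" .
    have "L \<ge> 0"
      using \<open>K \<ge> 0\<close> by (simp add: L_def)
    have "cmod (f z) = (cmod (f z) * exp (- d * Re (T z))) * exp (d * Re (T z))"
      by (simp flip: exp_add)
    also have "\<dots> \<le> L * exp (64 * C * r)"
      using fz dT \<open>L \<ge> 0\<close> by (intro mult_mono) auto
    also have "\<dots> = L * exp (64 * C) * exp (128 * C * cmod z)"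
      by (simp add: r_def algebra_simps flip: exp_add)
    finally show ?thesis .
  qed
  then show ?thesis by blast
qed

lemma cmod_one_plus_of_real: "x \<ge> 0 \<Longrightarrow> cmod (1 + of_real x) = 1 + x"
  by (metis abs_of_nonneg add_nonneg_nonneg norm_of_real of_real_1 of_real_add zero_le_one)

lemma cmod_one_plus_ge:
  assumes "Re s \<ge> 0"
  shows "cmod (1 + s) \<ge> 1" "cmod s \<le> cmod (1 + s)"
proof -
  show "cmod (1 + s) \<ge> 1"
    using complex_Re_le_cmod[of "1 + s"] assms by simp
  have "(cmod s)\<^sup>2 \<le> (cmod (1 + s))\<^sup>2"
    unfolding cmod_power2 using assms by (simp add: power2_eq_square algebra_simps)
  then show "cmod s \<le> cmod (1 + s)"
    by (rule power2_le_imp_le) simp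
qed

text \<open>Exponential type is the critical order for a half plane (exp(s) again), but it is
  subcritical for a quadrant. The bound on the positive real axis allows the half plane to be cut
  into two quadrants.\<close>

lemma Phragmen_Lindelof_half_plane:
  fixes f :: "complex \<Rightarrow> complex"
  assumes hol: "f holomorphic_on open_rhp" and cont: "continuous_on {s. Re s \<ge> 0} f"
    and axis: "\<And>s. Re s = 0 \<Longrightarrow> cmod (f s) \<le> M"
    and growth: "\<And>s. Re s > 0 \<Longrightarrow> cmod (f s) \<le> K * exp (C * (cmod (s + 1))\<^sup>2 / Re s)"
    and C: "C \<ge> 0" and K: "K \<ge> 0"
    and real: "\<And>x. x > 0 \<Longrightarrow> cmod (f (of_real x)) \<le> K' * (1 + x) ^ n"
    and z: "Re z > 0"
  shows "cmod (f z) \<le> M"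
proof -
  obtain N D where ND: "\<And>s. Re s > 0 \<Longrightarrow> cmod (f s) \<le> N * exp (D * cmod s)"
    using exponential_type_half_plane[OF hol cont axis growth C K] by blast
  have M0: "M \<ge> 0"
    by (rule order_trans[OF norm_ge_zero axis[of 0]]) simp
  define L where "L = max M K'"
  have L0: "L \<ge> 0"
    using M0 by (simp add: L_def)
  note one_le = cmod_one_plus_ge(1)
  have nz: "1 + s \<noteq> 0" if "Re s \<ge> 0" for s
    using one_le[OF that] by auto
  \<comment> \<open>Dividing by (1 + s)^n makes the function bounded on the positive axis and spoils
    nothing on the imaginary axis, since |1 + s| >= 1 there.\<close>
  define q where "q = (\<lambda>s. f s / (1 + s) ^ n)"
  have holq: "q holomorphic_on open_rhp"
    unfolding q_def using nz by (intro holomorphic_intros hol) (auto simp: open_rhp_def)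
  have contq: "continuous_on {s. Re s \<ge> 0} q"
    unfolding q_def using nz by (intro continuous_intros cont) auto
  have q_le: "cmod (q s) \<le> cmod (f s)" if "Re s \<ge> 0" for s
  proof -
    have "cmod (f s) / cmod (1 + s) ^ n \<le> cmod (f s) / 1"
      using one_le[OF that] by (intro divide_left_mono one_le_power) (auto simp: nz that)
    then show ?thesis by (simp add: q_def norm_divide norm_power)
  qed
  have q_real: "cmod (q (of_real x)) \<le> L" if "x \<ge> 0" for x :: real
  proof (cases "x = 0")
    case True
    then show ?thesis using axis[of 0] by (simp add: q_def L_def)
  next
    case False
    then have "cmod (f (of_real x)) \<le> L * (1 + x) ^ n"
      using real[of x] that
      by (intro order_trans[OF real] mult_right_mono) (auto simp: L_def)
    then show ?thesis
      using that False cmod_one_plus_of_real[OF that] by (simp add: q_def norm_divide norm_power divide_le_eq)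
  qed
  \<comment> \<open>A quadrant around the direction \<tau> pi/4 has \<delta> = pi/4, so any a < 2 is
    admissible; a = 3/2 beats exponential type, b = 1. The sign \<tau> treats both quadrants at
    once.\<close>
  have quadrant: "cmod (q s) \<le> L" if s: "Re s > 0" "\<tau> * Im s > 0" and \<tau>: "\<tau> = 1 \<or> \<tau> = -1" for s \<tau>
  proof (rule Phragmen_Lindelof_sector[where U = "{s. Re s > 0 \<and> \<tau> * Im s > 0}" and f = q
        and \<phi> = "\<tau> * pi / 4" and \<delta> = "pi / 4" and a = "3/2" and b = 1 and K = N and C = D])
    show opn: "open {s. Re s > 0 \<and> \<tau> * Im s > 0}"
      by (intro open_Collect_conj open_Collect_less continuous_intros)
    show "q holomorphic_on {s. Re s > 0 \<and> \<tau> * Im s > 0}"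
      using holq by (rule holomorphic_on_subset) (auto simp: open_rhp_def)
    show "s \<notin> \<real>\<^sub>\<le>\<^sub>0 \<and> \<bar>Im (Ln s) - \<tau> * pi / 4\<bar> \<le> pi / 4" if "s \<in> {s. Re s > 0 \<and> \<tau> * Im s > 0}" for s
    proof
      show "s \<notin> \<real>\<^sub>\<le>\<^sub>0"
        using that by (auto simp: complex_nonpos_Reals_iff)
      have "\<bar>Im (Ln s)\<bar> < pi / 2" "s \<noteq> 0"
        using that Re_Ln_pos_lt_imp[of s] by auto
      moreover have "\<tau> * Im (Ln s) > 0"
        using \<tau> that \<open>s \<noteq> 0\<close> by (auto simp: Im_Ln_eq divide_neg_pos)
      ultimately show "\<bar>Im (Ln s) - \<tau> * pi / 4\<bar> \<le> pi / 4"
        using \<tau> by (auto simp: abs_if split: if_splits)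
    qed
    show "cmod (q s) \<le> N * exp (D * cmod s powr 1)" if "s \<in> {s. Re s > 0 \<and> \<tau> * Im s > 0}" for s
      using that q_le[of s] ND[of s] by auto
    show "\<forall>\<^sub>F s in at \<xi> within {s. Re s > 0 \<and> \<tau> * Im s > 0}. cmod (q s) \<le> L + \<epsilon>"
      if \<xi>: "\<xi> \<in> frontier {s. Re s > 0 \<and> \<tau> * Im s > 0}" and "\<epsilon> > 0" for \<xi> \<epsilon>
    proof (rule eventually_norm_le_limit[OF contq])
      have "closure {s. Re s > 0 \<and> \<tau> * Im s > 0} \<subseteq> {s. Re s \<ge> 0 \<and> \<tau> * Im s \<ge> 0}"
        by (rule closure_minimal)
           (auto intro!: closed_Collect_conj closed_Collect_le continuous_intros)
      with \<xi> opn have cl: "Re \<xi> \<ge> 0" "\<tau> * Im \<xi> \<ge> 0" "\<not> (Re \<xi> > 0 \<and> \<tau> * Im \<xi> > 0)"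
        by (auto simp: frontier_def interior_open)
      show "\<xi> \<in> {s. Re s \<ge> 0}"
        using cl by simp
      show "cmod (q \<xi>) \<le> L"
      proof (cases "Re \<xi> = 0")
        case True
        then show ?thesis
          using q_le[of \<xi>] axis[of \<xi>] by (simp add: L_def)
      next
        case False
        then have "Im \<xi> = 0"
          using cl \<tau> by auto
        then have "\<xi> = of_real (Re \<xi>)"
          by (simp add: complex_eq_iff)
        then show ?thesis
          using q_real[of "Re \<xi>"] cl by metis
      qed
    qed (use that in auto)
  qed (use s L0 in auto)
  have poly_growth: "cmod (f s) \<le> L * cmod (1 + s) ^ n" if s: "Re s > 0" for s
  proof -
    consider "Im s > 0" | "Im s < 0" | "Im s = 0" by linarith
    then have "cmod (q s) \<le> L"
    proof cases
      case 3
      then have "s = of_real (Re s)"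
        by (simp add: complex_eq_iff)
      then show ?thesis
        using q_real[of "Re s"] s by (metis less_imp_le)
    qed (use quadrant[of s 1] quadrant[of s "-1"] s in auto)
    then show ?thesis
      using one_le[of s] nz[of s] s by (simp add: q_def norm_divide norm_power divide_le_eq)
  qed
  \<comment> \<open>Now \<delta> = pi/2 forces a < 1. With r = sqrt |s| one has |1 + s| <= (1 + r)^2
    <= exp(2r), so polynomial growth of degree n fits under exp(2 n |s|^(1/2)).\<close>
  show ?thesis
  proof (rule Phragmen_Lindelof_sector[OF open_open_rhp hol, where \<phi> = 0 and \<delta> = "pi / 2"
        and a = "3/4" and b = "1/2" and K = L and C = "2 * real n"])
    show "s \<notin> \<real>\<^sub>\<le>\<^sub>0 \<and> \<bar>Im (Ln s) - 0\<bar> \<le> pi / 2" if "s \<in> open_rhp" for s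
      using that Re_Ln_pos_lt_imp[of s] by (auto simp: complex_nonpos_Reals_iff open_rhp_def)
    show "\<forall>\<^sub>F s in at \<xi> within open_rhp. cmod (f s) \<le> M + \<epsilon>"
      if \<xi>: "\<xi> \<in> frontier open_rhp" and "\<epsilon> > 0" for \<xi> \<epsilon>
    proof (rule eventually_norm_le_limit[OF cont])
      have "Re \<xi> = 0"
        using \<xi> by (rule frontier_open_rhp)
      then show "cmod (f \<xi>) \<le> M" "\<xi> \<in> {s. Re s \<ge> 0}"
        using axis by auto
    qed (use that in \<open>auto simp: open_rhp_def\<close>)
    show "cmod (f s) \<le> L * exp (2 * real n * cmod s powr (1/2))" if "s \<in> open_rhp" for s
    proof -
      define r where "r = sqrt (cmod s)"
      have r: "r \<ge> 0" "cmod s = r\<^sup>2" by (auto simp: r_def)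
      have "cmod (1 + s) \<le> 1 + r\<^sup>2"
        using norm_triangle_ineq[of 1 s] r by simp
      also have "\<dots> \<le> (1 + r)\<^sup>2"
        using r by (simp add: power2_eq_square algebra_simps)
      also have "\<dots> \<le> (exp r)\<^sup>2"
        using r by (intro power_mono) auto
      finally have "cmod (1 + s) ^ n \<le> ((exp r)\<^sup>2) ^ n"
        by (intro power_mono) auto
      also have "\<dots> = exp (2 * real n * r)"
        by (simp flip: exp_of_nat_mult power_mult add: mult_ac)
      finally have "L * cmod (1 + s) ^ n \<le> L * exp (2 * real n * r)"
        using L0 by (intro mult_left_mono)
      moreover have "cmod s powr (1/2) = r"
        by (simp add: r_def powr_half_sqrt)
      ultimately show ?thesis
        using poly_growth[of s] that by (simp add: open_rhp_def)
    qed
  qed (use z M0 in \<open>auto simp: open_rhp_def\<close>)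
qed

section \<open>The two-constants and Harnack estimates\<close>

text \<open>The harmonic majorant jumps at the points i w and -i w, and \<open>f\<close> is merely
  bounded at infinity. So the maximum principle is applied to f exp(-\<open>\<Phi>\<close>) times a
  factor of modulus \<open>e s powr \<eta>\<close>, which tends to 0 at these three places;
  afterwards \<eta> tends to 0.\<close>

lemma two_constants_half_plane:
  fixes f :: "complex \<Rightarrow> complex"
  assumes hol: "f holomorphic_on open_rhp" and cont: "continuous_on {s. Re s \<ge> 0} f"
    and bdd: "\<And>s. Re s > 0 \<Longrightarrow> cmod (f s) \<le> B"
    and w: "w > 0" and \<rho>: "\<rho> > 0" and S: "S > 0"
    and inner: "\<And>y. \<bar>y\<bar> \<le> w \<Longrightarrow> cmod (f (\<i> * of_real y)) \<le> \<rho>"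
    and outer: "\<And>y. \<bar>y\<bar> > w \<Longrightarrow> cmod (f (\<i> * of_real y)) \<le> S"
    and x: "x > 0" and fx: "f (of_real x) \<noteq> 0"
  shows "pi / 2 * ln (cmod (f (of_real x))) \<le>
           arctan (w / x) * ln \<rho> + (pi / 2 - arctan (w / x)) * ln S"
proof -
  define \<Phi> where "\<Phi> = (\<lambda>s. of_real (ln S) +
    of_real ((ln \<rho> - ln S) / pi) * (- \<i>) * (Ln (s + \<i> * of_real w) - Ln (s - \<i> * of_real w)))"
  have Re\<Phi>: "Re (\<Phi> s) = ln S + (ln \<rho> - ln S) / pi *
      (Im (Ln (s + \<i> * of_real w)) - Im (Ln (s - \<i> * of_real w)))" for s
    by (simp add: \<Phi>_def)
  \<comment> \<open>The numerator vanishes at the two jump points, the cube makes the quotient decay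
    like 1/|s| at infinity, and |s + w| >= w keeps the denominator away from 0 on the closed half
    plane.\<close>
  define e where "e = (\<lambda>s. cmod ((s - \<i> * of_real w) * (s + \<i> * of_real w)) / cmod (s + of_real w) ^ 3)"
  have slit: "s + \<i> * of_real w \<notin> \<real>\<^sub>\<le>\<^sub>0" "s - \<i> * of_real w \<notin> \<real>\<^sub>\<le>\<^sub>0" "s + of_real w \<notin> \<real>\<^sub>\<le>\<^sub>0"
    if "Re s \<ge> 0" "s \<noteq> \<i> * of_real w" "s \<noteq> - \<i> * of_real w" for s
    using that w by (auto simp: complex_nonpos_Reals_iff complex_eq_iff)
  have nw: "cmod (s + of_real w) \<ge> w" if "Re s \<ge> 0" for s
    using complex_Re_le_cmod[of "s + of_real w"] that by simp
  have e_le: "e s \<le> 1 / cmod (s + of_real w)" if "Re s \<ge> 0" for s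
  proof -
    have "cmod ((s - \<i> * of_real w) * (s + \<i> * of_real w)) = cmod (s\<^sup>2 + of_real (w\<^sup>2))"
      by (simp add: algebra_simps power2_eq_square)
    also have "\<dots> \<le> (cmod s)\<^sup>2 + w\<^sup>2"
      using norm_triangle_ineq[of "s\<^sup>2" "of_real (w\<^sup>2)"] by (simp add: norm_power)
    also have "\<dots> \<le> (cmod (s + of_real w))\<^sup>2"
      unfolding cmod_power2 using that w by (simp add: power2_eq_square algebra_simps)
    finally have "e s \<le> (cmod (s + of_real w))\<^sup>2 / cmod (s + of_real w) ^ 3"
      unfolding e_def by (rule divide_right_mono) simp
    also have "\<dots> = 1 / cmod (s + of_real w)"
      by (simp add: power2_eq_square power3_eq_cube)
    finally show ?thesis .
  qed
  have e_le': "e s \<le> 1 / w" if "Re s \<ge> 0" for s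
    using e_le[OF that] nw[OF that] w by (meson frac_le order_trans zero_le_one order_refl)
  have e0: "e s \<ge> 0" for s
    by (simp add: e_def)
  have Arg_bd: "\<bar>Im (Ln (s + \<i> * of_real w))\<bar> \<le> pi / 2" "\<bar>Im (Ln (s - \<i> * of_real w))\<bar> \<le> pi / 2"
    if "Re s > 0" for s
    using that Re_Ln_pos_lt_imp[of "s + \<i> * of_real w"] Re_Ln_pos_lt_imp[of "s - \<i> * of_real w"] by auto
  define c where "c = \<bar>ln S\<bar> + \<bar>ln \<rho> - ln S\<bar>"
  have \<Phi>_bd: "- Re (\<Phi> s) \<le> c" if "Re s > 0" for s
  proof -
    have "\<bar>(ln \<rho> - ln S) / pi * (Im (Ln (s + \<i> * of_real w)) - Im (Ln (s - \<i> * of_real w)))\<bar> \<le>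
      \<bar>(ln \<rho> - ln S) / pi\<bar> * pi"
      unfolding abs_mult using Arg_bd[OF that] by (intro mult_left_mono) auto
    also have "\<dots> = \<bar>ln \<rho> - ln S\<bar>"
      by (simp add: abs_divide)
    finally show ?thesis
      unfolding Re\<Phi> c_def by linarith
  qed
  have B0: "B \<ge> 0"
    by (rule order_trans[OF norm_ge_zero bdd[of 1]]) simp
  have main: "cmod (f (of_real x)) * exp (- Re (\<Phi> (of_real x))) * e (of_real x) powr \<eta> \<le> (1 / w) powr \<eta>"
    if \<eta>: "\<eta> > 0" for \<eta> :: real
  proof -
    \<comment> \<open>The logarithms realise \<open>e s powr \<eta>\<close> as the modulus of a
      holomorphic function; their arguments avoid the slit by \<open>slit\<close>.\<close>
    define W where "W = (\<lambda>s. f s * exp (- \<Phi> s) * exp (of_real \<eta> *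
      (Ln (s - \<i> * of_real w) + Ln (s + \<i> * of_real w) - 3 * Ln (s + of_real w))))"
    have norm_W: "cmod (W s) = cmod (f s) * exp (- Re (\<Phi> s)) * e s powr \<eta>"
      if "Re s \<ge> 0" "s \<noteq> \<i> * of_real w" "s \<noteq> - \<i> * of_real w" for s
    proof -
      have nz: "s - \<i> * of_real w \<noteq> 0" "s + \<i> * of_real w \<noteq> 0" "s + of_real w \<noteq> 0"
        using slit[OF that] by auto
      then have "e s powr \<eta> = exp (\<eta> * (ln (cmod (s - \<i> * of_real w)) + ln (cmod (s + \<i> * of_real w))
          - 3 * ln (cmod (s + of_real w))))"
        by (simp add: e_def powr_def ln_div ln_mult norm_mult ln_realpow)
      with nz show ?thesis
        by (simp add: W_def norm_mult)
    qed
    have contW: "continuous_on ({s. Re s \<ge> 0} - {\<i> * of_real w, - \<i> * of_real w}) W"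
      unfolding W_def \<Phi>_def using slit
      by (intro continuous_intros continuous_on_subset[OF cont]) auto
    have off: "s \<noteq> \<i> * of_real w" "s \<noteq> - \<i> * of_real w" if "Re s > 0" for s
      using that by auto
    have W_le: "cmod (W s) \<le> B * exp c * e s powr \<eta>" if "Re s > 0" for s
      using that norm_W[of s] off[OF that] \<Phi>_bd[OF that] bdd[OF that] B0
      by (auto intro!: mult_mono)
    have "cmod (W (of_real x)) \<le> (1 / w) powr \<eta>"
    proof (rule maximum_modulus_limsup[OF open_open_rhp, where f = W])
      show "W holomorphic_on open_rhp"
        unfolding W_def \<Phi>_def using slit off
        by (intro holomorphic_intros hol) (auto simp: open_rhp_def)
      show "of_real x \<in> open_rhp"
        using x by (simp add: open_rhp_def)
      \<comment> \<open>This serves the two jump points and infinity alike: wherever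
        \<open>e\<close> tends to 0, the crude bound \<open>W_le\<close> tends to 0.\<close>
      have decay: "\<forall>\<^sub>F s in F. cmod (W s) \<le> (1 / w) powr \<eta> + \<epsilon>"
        if "(u \<longlongrightarrow> 0) F" "\<forall>\<^sub>F s in F. Re s > 0 \<and> e s \<le> u s" "\<epsilon> > 0"
        for F \<epsilon> and u :: "complex \<Rightarrow> real"
      proof -
        have "(e \<longlongrightarrow> 0) F"
          using that by (intro tendsto_sandwich[OF _ _ tendsto_const that(1)])
            (auto simp: e0 elim!: eventually_mono)
        then have "((\<lambda>s. B * exp c * e s powr \<eta>) \<longlongrightarrow> B * exp c * (0 powr \<eta>)) F"
          using \<eta> e0 by (intro tendsto_intros tendsto_powr') auto
        then have "\<forall>\<^sub>F s in F. B * exp c * e s powr \<eta> < \<epsilon>"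
          by (rule order_tendstoD) (use that \<eta> in auto)
        with that(2) show ?thesis
        proof eventually_elim
          case (elim s)
          then show ?case
            using W_le[of s] powr_ge_zero[of "1 / w" \<eta>] by linarith
        qed
      qed
      fix \<epsilon> :: real assume \<epsilon>: "\<epsilon> > 0"
      show "\<forall>\<^sub>F s in at_infinity. s \<in> open_rhp \<longrightarrow> cmod (W s) \<le> (1 / w) powr \<eta> + \<epsilon>"
      proof -
        have "((\<lambda>s. 1 / cmod (s + of_real w)) \<longlongrightarrow> 0) at_infinity"
          by (intro tendsto_divide_0[OF tendsto_const] filterlim_at_top_imp_at_infinity
              filterlim_compose[OF filterlim_norm_at_top]
              tendsto_add_filterlim_at_infinity'[OF filterlim_ident tendsto_const])
        then have "((\<lambda>s. 1 / cmod (s + of_real w)) \<longlongrightarrow> 0) (inf at_infinity (principal open_rhp))"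
          by (rule tendsto_mono[rotated]) simp
        then have "\<forall>\<^sub>F s in inf at_infinity (principal open_rhp). cmod (W s) \<le> (1 / w) powr \<eta> + \<epsilon>"
          by (rule decay)
             (auto simp: eventually_inf_principal open_rhp_def e_le \<epsilon>)
        then show ?thesis
          by (simp add: eventually_inf_principal)
      qed
      fix \<xi> assume "\<xi> \<in> frontier open_rhp"
      then have \<xi>: "Re \<xi> = 0"
        by (rule frontier_open_rhp)
      define y where "y = Im \<xi>"
      have \<xi>y: "\<xi> = \<i> * of_real y"
        using \<xi> by (simp add: y_def complex_eq_iff)
      show "\<forall>\<^sub>F s in at \<xi> within open_rhp. cmod (W s) \<le> (1 / w) powr \<eta> + \<epsilon>"
      proof (cases "\<xi> = \<i> * of_real w \<or> \<xi> = - \<i> * of_real w")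
        case True
        have "isCont e \<xi>"
          unfolding e_def using nw[of \<xi>] \<xi> w by (intro continuous_intros) auto
        moreover have "e \<xi> = 0"
          using True by (auto simp: e_def)
        ultimately have "(e \<longlongrightarrow> 0) (at \<xi> within open_rhp)"
          by (metis isCont_def tendsto_within_subset subset_UNIV)
        then show ?thesis
          by (rule decay) (auto simp: eventually_at_filter open_rhp_def \<epsilon>)
      next
        case False
        show ?thesis
        proof (rule eventually_norm_le_limit[OF contW])
          have "cmod (f \<xi>) \<le> exp (Re (\<Phi> \<xi>))"
          proof -
            \<comment> \<open>On the axis both arguments are pi/2 or -pi/2. They have opposite signs
              inside the segment, where Re \<open>\<Phi>\<close> is ln \<rho>, and equal signs
              outside, where it is ln S.\<close>
            have sum_eq: "\<xi> + \<i> * of_real w = \<i> * of_real (y + w)"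
                "\<xi> - \<i> * of_real w = \<i> * of_real (y - w)"
              by (simp_all add: \<xi>y algebra_simps)
            have "\<bar>y\<bar> \<noteq> w"
              using False by (auto simp: \<xi>y abs_if split: if_splits)
            then consider "\<bar>y\<bar> < w" | "y > w" | "y < -w"
              by linarith
            then show ?thesis
            proof cases
              case 1
              then have args: "Im (Ln (\<xi> + \<i> * of_real w)) = pi / 2" "Im (Ln (\<xi> - \<i> * of_real w)) = - pi / 2"
                unfolding sum_eq using w by (simp_all add: Im_Ln_eq del: of_real_add of_real_diff)
              then show ?thesis
                using inner[of y] \<rho> pi_gt_zero 1 w unfolding Re\<Phi> args by (simp flip: \<xi>y)
            next
              case 2
              then have args: "Im (Ln (\<xi> + \<i> * of_real w)) = pi / 2" "Im (Ln (\<xi> - \<i> * of_real w)) = pi / 2"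
                unfolding sum_eq using w by (simp_all add: Im_Ln_eq del: of_real_add of_real_diff)
              then show ?thesis
                using outer[of y] S 2 w unfolding Re\<Phi> args by (simp flip: \<xi>y)
            next
              case 3
              then have args: "Im (Ln (\<xi> + \<i> * of_real w)) = - pi / 2" "Im (Ln (\<xi> - \<i> * of_real w)) = - pi / 2"
                unfolding sum_eq using w by (simp_all add: Im_Ln_eq del: of_real_add of_real_diff)
              then show ?thesis
                using outer[of y] S 3 w unfolding Re\<Phi> args by (simp flip: \<xi>y)
            qed
          qed
          then have "cmod (f \<xi>) * exp (- Re (\<Phi> \<xi>)) \<le> 1"
            by (simp add: exp_minus field_simps)
          then have "cmod (f \<xi>) * exp (- Re (\<Phi> \<xi>)) * e \<xi> powr \<eta> \<le> 1 * (1 / w) powr \<eta>"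
            using e_le'[of \<xi>] e0 \<xi> \<eta> by (intro mult_mono powr_mono2) auto
          then show "cmod (W \<xi>) \<le> (1 / w) powr \<eta>"
            using norm_W[of \<xi>] False \<xi> by simp
        qed (use False \<xi> \<epsilon> in \<open>auto simp: open_rhp_def\<close>)
      qed
    qed
    then show ?thesis
      using norm_W[of "of_real x"] off[of "of_real x"] x by simp
  qed
  have "cmod (f (of_real x)) * exp (- Re (\<Phi> (of_real x))) \<le> 1"
  proof (rule tendsto_le)
    have ex: "e (of_real x) \<noteq> 0"
      using x w by (auto simp: e_def complex_eq_iff)
    show "((\<lambda>\<eta>. (1 / w) powr \<eta>) \<longlongrightarrow> 1) (at_right 0)"
      by (rule tendsto_eq_intros refl | use w in simp)+
    show "((\<lambda>\<eta>. cmod (f (of_real x)) * exp (- Re (\<Phi> (of_real x))) * e (of_real x) powr \<eta>) \<longlongrightarrow>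
        cmod (f (of_real x)) * exp (- Re (\<Phi> (of_real x)))) (at_right 0)"
      by (rule tendsto_eq_intros refl | use ex in simp)+
    show "\<forall>\<^sub>F \<eta> in at_right 0. cmod (f (of_real x)) * exp (- Re (\<Phi> (of_real x))) * e (of_real x) powr \<eta>
        \<le> (1 / w) powr \<eta>"
      using main by (auto intro!: eventually_mono[OF eventually_at_right_less[of 0]])
  qed simp
  then have "cmod (f (of_real x)) \<le> exp (Re (\<Phi> (of_real x)))"
    by (simp add: exp_minus field_simps)
  then have "ln (cmod (f (of_real x))) \<le> Re (\<Phi> (of_real x))"
    using fx by (metis ln_exp ln_le_cancel_iff exp_gt_zero zero_less_norm_iff)
  also have "Re (\<Phi> (of_real x)) = ln S + (ln \<rho> - ln S) / pi * (2 * arctan (w / x))"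
  proof -
    have "of_real x + \<i> * of_real w \<noteq> 0" "of_real x - \<i> * of_real w \<noteq> 0"
      using x by (auto simp: complex_eq_iff)
    then show ?thesis
      unfolding Re\<Phi> using x by (simp add: Im_Ln_eq arctan_minus)
  qed
  finally have "pi / 2 * ln (cmod (f (of_real x))) \<le>
      pi / 2 * (ln S + (ln \<rho> - ln S) / pi * (2 * arctan (w / x)))"
    by (rule mult_left_mono) simp
  also have "\<dots> = arctan (w / x) * ln \<rho> + (pi / 2 - arctan (w / x)) * ln S"
    by (simp add: field_simps)
  finally show ?thesis .
qed

text \<open>A normalised -log h has positive real part. Cayley transforms of the source and of the
  target turn it into a self-map of the disc fixing 0, and Schwarz's lemma bounds it at s by its
  value at 1; an upper bound for -log |h| is a lower bound for |h|.\<close>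

lemma Harnack_half_plane:
  fixes h :: "complex \<Rightarrow> complex"
  assumes hol: "h holomorphic_on open_rhp"
    and nz: "\<And>s. Re s > 0 \<Longrightarrow> h s \<noteq> 0" and lt1: "\<And>s. Re s > 0 \<Longrightarrow> cmod (h s) < 1"
    and s: "Re s > 0"
  shows "1 / cmod (h s) \<le> exp (- ln (cmod (h 1)) * (cmod (s + 1))\<^sup>2 / Re s)"
proof -
  have "simply_connected open_rhp"
    unfolding open_rhp_def by (intro convex_imp_simply_connected convex_halfspace_Re_gt)
  moreover note open_open_rhp
  ultimately obtain p where holp: "p holomorphic_on open_rhp" and p: "\<And>s. Re s > 0 \<Longrightarrow> h s = exp (p s)"
    using hol nz by (auto simp: simply_connected_eq_holomorphic_log open_rhp_def)
  \<comment> \<open>The imaginary constant makes q(1) a positive real number \<open>a\<close>, which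
    (u - a) / (u + a) sends to 0.\<close>
  define q where "q = (\<lambda>s. \<i> * of_real (Im (p 1)) - p s)"
  have cmod_h: "cmod (h s) = exp (- Re (q s))" if "Re s > 0" for s
    using p[OF that] by (simp add: q_def)
  have q_pos: "Re (q s) > 0" if "Re s > 0" for s
    using lt1[OF that] cmod_h[OF that] by simp
  define a where "a = Re (q 1)"
  have a: "a > 0" "q 1 = of_real a" "a = - ln (cmod (h 1))"
    using q_pos[of 1] cmod_h[of 1] by (auto simp: a_def q_def complex_eq_iff)
  define m where "m = (\<lambda>w::complex. (1 + w) / (1 - w))"
  have ne1: "w \<noteq> 1" if "cmod w < 1" for w
    using that by auto
  have Re_m: "Re (m w) > 0" if "cmod w < 1" for w
  proof -
    have "Re (m w) = (1 - (cmod w)\<^sup>2) / (cmod (1 - w))\<^sup>2"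
      unfolding m_def cmod_power2 by (simp add: Re_divide power2_eq_square algebra_simps)
    then show ?thesis
      using that ne1[OF that] by (simp add: power_less_one_iff abs_square_less_1)
  qed
  define \<phi> where "\<phi> = (\<lambda>w. (q (m w) - of_real a) / (q (m w) + of_real a))"
  have norm_\<phi>: "cmod ((u - of_real a) / (u + of_real a)) < 1" if "Re u > 0" for u
  proof -
    have "0 < Re u * a" using that a(1) by simp
    then have "(cmod (u - of_real a))\<^sup>2 < (cmod (u + of_real a))\<^sup>2"
      unfolding cmod_power2 by (simp add: power2_eq_square algebra_simps)
    then have "cmod (u - of_real a) < cmod (u + of_real a)"
      by (rule power2_less_imp_less) simp
    then show ?thesis
      by (simp add: norm_divide divide_less_eq)
  qed
  have "q (m w) + of_real a \<noteq> 0" if "cmod w < 1" for w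
    using q_pos[OF Re_m[OF that]] a by (auto simp: complex_eq_iff)
  moreover have holm: "m holomorphic_on ball 0 1"
    unfolding m_def by (intro holomorphic_intros) auto
  moreover have holpm: "(\<lambda>w. p (m w)) holomorphic_on ball 0 1"
    by (rule holomorphic_on_compose_gen[OF holm holp, unfolded o_def])
       (use Re_m in \<open>auto simp: open_rhp_def\<close>)
  ultimately have hol\<phi>: "\<phi> holomorphic_on ball 0 1"
    unfolding \<phi>_def
    using holpm by (auto simp: q_def intro!: holomorphic_intros)
  define w where "w = (s - 1) / (s + 1)"
  have s1: "s + 1 \<noteq> 0" "s \<noteq> 0"
    using s by (auto simp: complex_eq_iff)
  have w2: "1 - (cmod w)\<^sup>2 = 4 * Re s / (cmod (s + 1))\<^sup>2"
  proof -
    have "(cmod (s + 1))\<^sup>2 - (cmod (s - 1))\<^sup>2 = 4 * Re s"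
      unfolding cmod_power2 by (simp add: power2_eq_square algebra_simps)
    moreover have "(cmod w)\<^sup>2 = (cmod (s - 1))\<^sup>2 / (cmod (s + 1))\<^sup>2"
      by (simp add: w_def norm_divide power_divide)
    then have "1 - (cmod w)\<^sup>2 = ((cmod (s + 1))\<^sup>2 - (cmod (s - 1))\<^sup>2) / (cmod (s + 1))\<^sup>2"
      using s1 by (simp add: diff_divide_distrib)
    ultimately show ?thesis
      by simp
  qed
  then have "(cmod w)\<^sup>2 < 1"
    using s s1 by (smt (verit) divide_pos_pos zero_less_norm_iff zero_less_power)
  then have w1: "cmod w < 1"
    by (simp add: abs_square_less_1)
  have mw: "m w = s"
  proof -
    have "1 + w = 2 * s / (s + 1)" "1 - w = 2 / (s + 1)"
      using s1 by (simp_all add: w_def field_simps)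
    then show ?thesis
      using s1 by (simp add: m_def)
  qed
  have "cmod (\<phi> w) \<le> cmod w"
  proof (rule Schwarz_Lemma(1)[OF hol\<phi>])
    show "\<phi> 0 = 0"
      by (simp add: \<phi>_def m_def a(2))
    show "cmod (\<phi> z) < 1" if "cmod z < 1" for z
      unfolding \<phi>_def using norm_\<phi> q_pos Re_m that by blast
  qed (rule w1)
  moreover have "q s + of_real a \<noteq> 0"
    using q_pos[OF s] a by (auto simp: complex_eq_iff)
  ultimately have "cmod (q s - of_real a) \<le> cmod w * cmod (q s + of_real a)"
    by (simp add: \<phi>_def mw norm_divide divide_le_eq)
  then have "(cmod (q s - of_real a))\<^sup>2 \<le> (cmod w)\<^sup>2 * (cmod (q s + of_real a))\<^sup>2"
    by (metis norm_ge_zero power_mono power_mult_distrib)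
  then have "(Re (q s) - a)\<^sup>2 + (Im (q s))\<^sup>2 \<le> (cmod w)\<^sup>2 * ((Re (q s) + a)\<^sup>2 + (Im (q s))\<^sup>2)"
    unfolding cmod_power2[of "q s - of_real a"] cmod_power2[of "q s + of_real a"] by simp
  \<comment> \<open>The imaginary part has weight 1 on the left and |w|^2 <= 1 on the right, so it
    can be discarded.\<close>
  moreover have "(cmod w)\<^sup>2 * (Im (q s))\<^sup>2 \<le> (Im (q s))\<^sup>2"
    using w1 by (intro mult_left_le_one_le) (auto simp: abs_square_le_1)
  ultimately have "(Re (q s) - a)\<^sup>2 \<le> (cmod w)\<^sup>2 * (Re (q s) + a)\<^sup>2"
    by (simp add: algebra_simps)
  then have "(Re (q s) - a)\<^sup>2 \<le> (cmod w * (Re (q s) + a))\<^sup>2"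
    by (simp add: power_mult_distrib)
  then have "Re (q s) - a \<le> cmod w * (Re (q s) + a)"
    by (rule power2_le_imp_le) (use q_pos[OF s] a(1) in simp)
  then have "Re (q s) * (1 - cmod w) \<le> a * (1 + cmod w)"
    by (simp add: algebra_simps)
  \<comment> \<open>The extra factor creates 1 - |w|^2 = 4 Re s / |s + 1|^2 on the left; the
    resulting (1 + |w|)^2 <= 4 on the right cancels the 4.\<close>
  then have "Re (q s) * (1 - cmod w) * (1 + cmod w) \<le> a * (1 + cmod w) * (1 + cmod w)"
    by (rule mult_right_mono) simp
  also have "\<dots> \<le> a * 4"
    using a(1) w1 mult_mono[of "1 + cmod w" 2 "1 + cmod w" 2] by (simp add: mult.assoc del: distrib_left distrib_right)
  finally have "Re (q s) * (1 - (cmod w)\<^sup>2) \<le> a * 4"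
    by (simp add: power2_eq_square algebra_simps)
  then have "Re (q s) \<le> a * (cmod (s + 1))\<^sup>2 / Re s"
    unfolding w2 using s s1(1) by (simp add: pos_le_divide_eq pos_divide_le_eq mult_ac)
  moreover have "1 / cmod (h s) = exp (Re (q s))"
    unfolding cmod_h[OF s] by (simp add: exp_minus inverse_eq_divide)
  ultimately show ?thesis
    by (simp flip: a(3))
qed

section \<open>Quotients with a denominator of polynomial growth\<close>

text \<open>Roots on the imaginary axis are put into \<open>U\<close>, so that a later division by
  \<open>T\<close> creates no singularity on the axis.\<close>

lemma poly_split_open_rhp:
  fixes p :: "complex poly"
  assumes "p \<noteq> 0"
  shows "\<exists>T U. p = T * U \<and> (\<forall>z. poly T z = 0 \<longrightarrow> Re z > 0) \<and> (\<forall>z. Re z > 0 \<longrightarrow> poly U z \<noteq> 0)"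
  using assms
proof (induction "degree p" arbitrary: p rule: less_induct)
  case less
  show ?case
  proof (cases "\<exists>z. Re z > 0 \<and> poly p z = 0")
    case True
    then obtain z where z: "Re z > 0" "poly p z = 0" by blast
    then obtain q where q: "p = [:- z, 1:] * q"
      by (auto simp: poly_eq_0_iff_dvd)
    with less have "q \<noteq> 0" by auto
    then have "degree q < degree p"
      unfolding q by (subst degree_mult_eq) auto
    with less(1) \<open>q \<noteq> 0\<close> obtain T U where TU: "q = T * U" "\<forall>z. poly T z = 0 \<longrightarrow> Re z > 0"
      "\<forall>z. Re z > 0 \<longrightarrow> poly U z \<noteq> 0" by blast
    show ?thesis
    proof (intro exI conjI)
      show "p = ([:- z, 1:] * T) * U"
        by (simp only: q TU mult.assoc)
    qed (use TU z in auto)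
  next
    case False
    then show ?thesis
      by (intro exI[of _ 1] exI[of _ p]) auto
  qed
qed

text \<open>Powers of |1 + s| serve as the scale because |1 + s| >= 1 on the closed right half
  plane: exponents can be raised freely, which fails for |s| near 0.\<close>

definition poly_bounded :: "(complex \<Rightarrow> complex) \<Rightarrow> bool" where
  "poly_bounded f \<longleftrightarrow> (\<exists>K\<ge>0. \<exists>n. \<forall>s. Re s \<ge> 0 \<longrightarrow> cmod (f s) \<le> K * cmod (1 + s) ^ n)"

lemma poly_bounded_mult:
  assumes "poly_bounded f" "poly_bounded g"
  shows "poly_bounded (\<lambda>s. f s * g s)"
proof -
  obtain K k L l where *: "K \<ge> 0" "\<And>s. Re s \<ge> 0 \<Longrightarrow> cmod (f s) \<le> K * cmod (1 + s) ^ k"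
      "L \<ge> 0" "\<And>s. Re s \<ge> 0 \<Longrightarrow> cmod (g s) \<le> L * cmod (1 + s) ^ l"
    using assms by (auto simp: poly_bounded_def)
  have "cmod (f s * g s) \<le> (K * L) * cmod (1 + s) ^ (k + l)" if "Re s \<ge> 0" for s
    using mult_mono[OF *(2)[OF that] *(4)[OF that]] * by (simp add: norm_mult power_add mult_ac)
  with * show ?thesis
    unfolding poly_bounded_def by (metis mult_nonneg_nonneg)
qed

lemma poly_bounded_add:
  assumes "poly_bounded f" "poly_bounded g"
  shows "poly_bounded (\<lambda>s. f s + g s)"
proof -
  obtain K k L l where *: "K \<ge> 0" "\<And>s. Re s \<ge> 0 \<Longrightarrow> cmod (f s) \<le> K * cmod (1 + s) ^ k"
      "L \<ge> 0" "\<And>s. Re s \<ge> 0 \<Longrightarrow> cmod (g s) \<le> L * cmod (1 + s) ^ l"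
    using assms by (auto simp: poly_bounded_def)
  have "cmod (f s + g s) \<le> (K + L) * cmod (1 + s) ^ (k + l)" if s: "Re s \<ge> 0" for s
  proof -
    have "cmod (f s + g s) \<le> K * cmod (1 + s) ^ k + L * cmod (1 + s) ^ l"
      using norm_triangle_ineq[of "f s" "g s"] *(2)[OF s] *(4)[OF s] by linarith
    also have "\<dots> \<le> K * cmod (1 + s) ^ (k + l) + L * cmod (1 + s) ^ (k + l)"
      using cmod_one_plus_ge[OF s] * by (intro add_mono mult_left_mono power_increasing) auto
    finally show ?thesis
      by (simp add: algebra_simps)
  qed
  with * show ?thesis
    unfolding poly_bounded_def by (metis add_nonneg_nonneg)
qed

lemma poly_bounded_bounded:
  assumes "\<And>s. Re s \<ge> 0 \<Longrightarrow> cmod (f s) \<le> K"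
  shows "poly_bounded f"
  unfolding poly_bounded_def
proof (intro exI[of _ "max K 0"] conjI exI[of _ 0])
  show "\<forall>s. 0 \<le> Re s \<longrightarrow> cmod (f s) \<le> max K 0 * cmod (1 + s) ^ 0"
    using assms by (auto simp: le_max_iff_disj)
qed simp

lemma poly_bounded_poly: "poly_bounded (poly p)"
proof (induction p)
  case 0
  then show ?case by (simp add: poly_bounded_bounded[where K = 0])
next
  case (pCons a p)
  have "poly_bounded (\<lambda>s. s)"
    unfolding poly_bounded_def using cmod_one_plus_ge by (intro exI[of _ 1] conjI) (auto intro!: exI[of _ 1])
  moreover have "poly_bounded (\<lambda>s. a)"
    by (rule poly_bounded_bounded[where K = "cmod a"]) simp
  ultimately show ?case
    using pCons by (simp add: poly_bounded_add poly_bounded_mult)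
qed

lemma poly_bounded_below:
  fixes p :: "complex poly"
  assumes "p \<noteq> 0"
  shows "\<exists>c>0. \<exists>R. \<forall>s. cmod s \<ge> R \<longrightarrow> cmod (poly p s) \<ge> c"
proof (cases p)
  case (pCons a q)
  show ?thesis
  proof (cases "q = 0")
    case True
    then have "a \<noteq> 0" "\<And>s. poly p s = a"
      using assms pCons by auto
    then show ?thesis
      by (intro exI[of _ "cmod a"]) auto
  next
    case False
    from poly_infinity[OF this, of 1 a] show ?thesis
      unfolding pCons by (intro exI[of _ 1]) auto
  qed
qed

text \<open>
  \<open>U / f\<close> is a zero-free function of polynomial growth, where \<open>U\<close> collects the zeros of the
  numerator \<open>p\<close> outside the open right half plane. Harnack's inequality turns this upper bound
  into a lower one, which is the growth bound needed for \<open>f\<close>.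
\<close>

lemma bounded_by_axis_bound:
  fixes f F :: "complex \<Rightarrow> complex" and p a b :: "complex poly"
  assumes hol: "f holomorphic_on open_rhp" and cont: "continuous_on {s. Re s \<ge> 0} f"
    and nz: "\<And>s. Re s > 0 \<Longrightarrow> f s \<noteq> 0"
    and contF: "continuous_on UNIV F" and F: "poly_bounded F"
    and c: "c > 0" "\<forall>\<^sub>F x::real in at_top. cmod (F (of_real x)) \<ge> c"
    and p: "p \<noteq> 0" and a: "a \<noteq> 0" "\<And>s. Re s = 0 \<Longrightarrow> poly a s \<noteq> 0" and b: "b \<noteq> 0"
    and eq: "\<And>s. Re s \<ge> 0 \<Longrightarrow> f s * (F s * poly b s) = poly p s * poly a s"
    and axis: "\<And>s. Re s = 0 \<Longrightarrow> cmod (f s) \<le> M"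
    and z: "Re z > 0"
  shows "cmod (f z) \<le> M"
proof -
  obtain T U where TU: "p = T * U" "\<And>s. poly T s = 0 \<Longrightarrow> Re s > 0" "\<And>s. Re s > 0 \<Longrightarrow> poly U s \<noteq> 0"
    using poly_split_open_rhp[OF p] by blast
  define h where "h = (\<lambda>s. poly U s / f s)"
  have h: "h s * poly (T * a) s = F s * poly b s" if "Re s > 0" for s
  proof -
    have "f s * (h s * poly (T * a) s) = f s * (F s * poly b s)"
      using eq[of s] that nz[OF that] by (simp add: h_def TU)
    then show ?thesis
      using nz[OF that] by simp
  qed
  have "T * a \<noteq> 0"
    using p a TU by auto
  then obtain d R where d: "d > 0" and R: "\<And>s. cmod s \<ge> R \<Longrightarrow> cmod (poly (T * a) s) \<ge> d"
    using poly_bounded_below by blast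
  obtain K n where K: "K \<ge> 0" "\<And>s. Re s \<ge> 0 \<Longrightarrow> cmod (F s * poly b s) \<le> K * cmod (1 + s) ^ n"
    using poly_bounded_mult[OF F poly_bounded_poly[of b]] by (auto simp: poly_bounded_def)
  have large: "cmod (h s) \<le> K / d * cmod (1 + s) ^ n" if "Re s > 0" "cmod s \<ge> R" for s
  proof -
    have "cmod (h s) * d \<le> cmod (h s) * cmod (poly (T * a) s)"
      using R that by (intro mult_left_mono) auto
    also have "\<dots> \<le> K * cmod (1 + s) ^ n"
      using K(2)[of s] h[of s] that by (simp flip: norm_mult)
    finally show ?thesis
      using d by (simp add: field_simps)
  qed
  \<comment> \<open>A continuous extension of \<open>h\<close> to the closed half plane. On the axis
    \<open>f\<close> may vanish, so U/f is replaced there by F b / (T a), whose denominator has no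
    zero on the axis. Compactness of \<open>D\<close> then bounds \<open>h\<close> where
    \<open>large\<close> does not apply.\<close>
  define v where "v = (\<lambda>s. if Re s > 0 then h s else F s * poly b s / poly (T * a) s)"
  define D where "D = {s. Re s \<ge> 0} \<inter> cball 0 R"
  have contv: "continuous_on {s. Re s \<ge> 0} v"
    unfolding continuous_on_eq_continuous_within
  proof
    fix \<xi> :: complex assume "\<xi> \<in> {s. Re s \<ge> 0}"
    then consider "Re \<xi> > 0" | "Re \<xi> = 0" by force
    then show "continuous (at \<xi> within {s. Re s \<ge> 0}) v"
    proof cases
      case 1
      have "h holomorphic_on open_rhp"
        unfolding h_def using nz by (intro holomorphic_intros hol) (auto simp: open_rhp_def)
      then have "continuous_on open_rhp h"
        by (rule holomorphic_on_imp_continuous_on)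
      then have "isCont h \<xi>"
        using 1 by (simp add: continuous_on_eq_continuous_at[OF open_open_rhp]) (simp add: open_rhp_def)
      moreover have "\<forall>\<^sub>F s in nhds \<xi>. s \<in> open_rhp"
        using 1 open_open_rhp by (intro eventually_nhds_in_open) (auto simp: open_rhp_def)
      then have "\<forall>\<^sub>F s in nhds \<xi>. h s = v s"
        by eventually_elim (auto simp: v_def open_rhp_def)
      ultimately have "isCont v \<xi>"
        using isCont_cong by blast
      then show ?thesis
        by (rule continuous_at_imp_continuous_at_within)
    next
      case 2
      then have "poly (T * a) \<xi> \<noteq> 0"
        using a TU(2)[of \<xi>] by auto
      have cF: "isCont F \<xi>"
        using contF by (simp add: continuous_on_eq_continuous_at)
      have "isCont (\<lambda>s. F s * poly b s / poly (T * a) s) \<xi>"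
        using \<open>poly (T * a) \<xi> \<noteq> 0\<close> cF by (intro continuous_intros) auto
      then have "continuous (at \<xi> within {s. Re s \<ge> 0}) (\<lambda>s. F s * poly b s / poly (T * a) s)"
        by (rule continuous_at_imp_continuous_at_within)
      then have lim: "((\<lambda>s. F s * poly b s / poly (T * a) s) \<longlongrightarrow> v \<xi>) (at \<xi> within {s. Re s \<ge> 0})"
        using 2 by (simp add: v_def continuous_within)
      have "isCont (poly (T * a)) \<xi>"
        by simp
      then have "\<forall>\<^sub>F s in at \<xi>. poly (T * a) s \<noteq> 0"
        using \<open>poly (T * a) \<xi> \<noteq> 0\<close> by (metis isCont_def tendsto_imp_eventually_ne)
      then have "\<forall>\<^sub>F s in at \<xi> within {s. Re s \<ge> 0}. poly (T * a) s \<noteq> 0"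
        by (rule filter_leD[OF at_le, rotated]) simp
      then have "\<forall>\<^sub>F s in at \<xi> within {s. Re s \<ge> 0}. F s * poly b s / poly (T * a) s = v s"
      proof eventually_elim
        case (elim s)
        then show ?case
          using h[of s] by (simp add: v_def field_simps)
      qed
      then show ?thesis
        unfolding continuous_within using lim by (rule Lim_transform_eventually[rotated])
    qed
  qed
  have "compact D"
    unfolding D_def by (intro closed_Int_compact closed_halfspace_Re_ge) auto
  moreover have "continuous_on D v"
    using contv by (rule continuous_on_subset) (auto simp: D_def)
  ultimately have "bounded (v ` D)"
    by (intro compact_imp_bounded compact_continuous_image)
  then obtain V where V: "\<And>s. s \<in> D \<Longrightarrow> cmod (v s) \<le> V"
    by (auto simp: bounded_iff)
  \<comment> \<open>The summand 1 makes the bound \<open>hL\<close> strict, so that the normalised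
    \<open>h1\<close> below maps into the open unit disc as Harnack's inequality demands.\<close>
  define L where "L = \<bar>V\<bar> + K / d + 1"
  have L: "L > 0"
    using K d by (simp add: L_def add_nonneg_pos)
  obtain K' n' where K': "K' \<ge> 0" "\<And>s. Re s \<ge> 0 \<Longrightarrow> cmod (poly U s) \<le> K' * cmod (1 + s) ^ n'"
    using poly_bounded_poly[of U] by (auto simp: poly_bounded_def)
  define k where "k = max n n'"
  have ge1: "cmod (1 + s) \<ge> 1" "1 + s \<noteq> 0" if "Re s > 0" for s
    using cmod_one_plus_ge[of s] that by auto
  have hL: "cmod (h s) < L * cmod (1 + s) ^ k" if s: "Re s > 0" for s
  proof (cases "cmod s \<ge> R")
    case True
    have "cmod (h s) \<le> K / d * cmod (1 + s) ^ n"
      by (rule large) fact+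
    also have "\<dots> \<le> K / d * cmod (1 + s) ^ k"
      using ge1[OF s] K d by (intro mult_left_mono power_increasing) (auto simp: k_def)
    also have "\<dots> < L * cmod (1 + s) ^ k"
      using ge1[OF s] by (intro mult_strict_right_mono) (auto simp: L_def intro: zero_less_power)
    finally show ?thesis .
  next
    case False
    have "cmod (h s) \<le> V"
      using V[of s] False s by (simp add: v_def D_def)
    also have "V < L * 1"
      using K d by (simp add: L_def add_nonneg_pos abs_if) (smt (verit) divide_nonneg_pos)
    also have "\<dots> \<le> L * cmod (1 + s) ^ k"
      using ge1[OF s] L by (intro mult_left_mono one_le_power) auto
    finally show ?thesis .
  qed
  define h1 where "h1 = (\<lambda>s. h s / (of_real L * (1 + s) ^ k))"
  have h1: "h1 holomorphic_on open_rhp"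
    unfolding h1_def h_def using ge1 L nz by (intro holomorphic_intros hol) (auto simp: open_rhp_def)
  have h1_nz: "h1 s \<noteq> 0" and h1_lt: "cmod (h1 s) < 1" if "Re s > 0" for s
  proof -
    show "h1 s \<noteq> 0"
      using ge1[OF that] nz[OF that] TU(3)[OF that] L by (simp add: h1_def h_def)
    show "cmod (h1 s) < 1"
      using hL[OF that] ge1[OF that] L
      by (simp add: h1_def norm_divide norm_mult norm_power divide_less_eq)
  qed
  define C where "C = - ln (cmod (h1 1))"
  have C: "C \<ge> 0"
    using h1_lt[of 1] h1_nz[of 1] by (simp add: C_def)
  have growth: "cmod (f s) \<le> K' / L * exp (C * (cmod (s + 1))\<^sup>2 / Re s)" if s: "Re s > 0" for s
  proof -
    have "f s = poly U s / h s"
      using nz[OF s] TU(3)[OF s] by (simp add: h_def)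
    also have "\<dots> = poly U s / (of_real L * (1 + s) ^ k) * (1 / h1 s)"
      using ge1[OF s] L by (simp add: h1_def)
    finally have fs: "cmod (f s) = cmod (poly U s) / (L * cmod (1 + s) ^ k) * (1 / cmod (h1 s))"
      using L by (simp add: norm_mult norm_divide norm_power)
    have "cmod (poly U s) \<le> K' * cmod (1 + s) ^ n'"
      using K' s by simp
    also have "\<dots> \<le> K' * cmod (1 + s) ^ k"
      using ge1[OF s] K' by (intro mult_left_mono power_increasing) (auto simp: k_def)
    finally have "cmod (poly U s) / (L * cmod (1 + s) ^ k) \<le> K' * cmod (1 + s) ^ k / (L * cmod (1 + s) ^ k)"
      using L by (intro divide_right_mono) auto
    also have "\<dots> = K' / L"
      using ge1[OF s] by simp
    finally show ?thesis
      unfolding fs C_def using K' L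
      by (intro mult_mono Harnack_half_plane[OF h1 h1_nz h1_lt s]) auto
  qed
  obtain e R' where e: "e > 0" and R': "\<And>s. cmod s \<ge> R' \<Longrightarrow> cmod (poly b s) \<ge> e"
    using poly_bounded_below[OF b] by blast
  obtain X0 where X0: "\<And>x. x \<ge> X0 \<Longrightarrow> cmod (F (of_real x)) \<ge> c"
    using c(2) by (auto simp: eventually_at_top_linorder)
  define X where "X = max 0 (max X0 R')"
  obtain A m where A: "A \<ge> 0" "\<And>s. Re s \<ge> 0 \<Longrightarrow> cmod (poly p s * poly a s) \<le> A * cmod (1 + s) ^ m"
    using poly_bounded_mult[OF poly_bounded_poly poly_bounded_poly, of p a] by (auto simp: poly_bounded_def)
  have "compact (of_real ` {0..X} :: complex set)"
    by (intro compact_continuous_image continuous_intros) auto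
  then have "bounded (f ` (of_real ` {0..X}))"
    by (intro compact_imp_bounded compact_continuous_image continuous_on_subset[OF cont]) auto
  then obtain Y where "\<forall>x\<in>{0..X}. cmod (f (of_real x)) \<le> Y"
    by (auto simp: bounded_iff)
  then have Y: "\<And>x. 0 \<le> x \<Longrightarrow> x \<le> X \<Longrightarrow> cmod (f (of_real x)) \<le> Y"
    by simp
  \<comment> \<open>Beyond \<open>X\<close> both F and b are bounded away from 0 on the real axis,
    so f = p a / (F b) is polynomially bounded there; on the interval up to \<open>X\<close>
    continuity is enough.\<close>
  have real: "cmod (f (of_real x)) \<le> (\<bar>Y\<bar> + A / (c * e)) * (1 + x) ^ m" if x: "x > 0" for x
  proof (cases "x \<le> X")
    case True
    have "cmod (f (of_real x)) \<le> \<bar>Y\<bar> * 1"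
      using Y[of x] x True by simp
    also have "\<dots> \<le> (\<bar>Y\<bar> + A / (c * e)) * (1 + x) ^ m"
      using A c e x by (intro mult_mono one_le_power) auto
    finally show ?thesis .
  next
    case False
    have norm1: "cmod (1 + of_real x) = 1 + x"
      using x by (intro cmod_one_plus_of_real) simp
    have "c * e \<le> cmod (F (of_real x)) * cmod (poly b (of_real x))"
      using X0[of x] R'[of "of_real x"] False c e x by (intro mult_mono) (auto simp: X_def)
    then have "cmod (f (of_real x)) * (c * e) \<le> cmod (f (of_real x) * (F (of_real x) * poly b (of_real x)))"
      by (simp add: norm_mult mult_left_mono)
    also have "\<dots> \<le> A * (1 + x) ^ m"
      using A(2)[of "of_real x"] eq[of "of_real x"] x norm1 by simp
    finally have "cmod (f (of_real x)) \<le> A / (c * e) * (1 + x) ^ m"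
      using c e by (simp add: field_simps)
    also have "\<dots> \<le> (\<bar>Y\<bar> + A / (c * e)) * (1 + x) ^ m"
      using x by (intro mult_right_mono) auto
    finally show ?thesis .
  qed
  show ?thesis
    using Phragmen_Lindelof_half_plane[OF hol cont axis growth C _ real z] K' L by simp
qed

section \<open>Structure of the modified sensitivity function\<close>

lemma prod_list_linear_factor_out:
  fixes z :: complex
  shows "\<exists>q. (\<forall>w. poly (\<Prod>x\<leftarrow>xs. [:- x, 1:]) w = (w - z) ^ count_list xs z * poly q w) \<and> poly q z \<noteq> 0"
proof (induction xs)
  case Nil
  then show ?case by (intro exI[of _ 1]) auto
next
  case (Cons x xs)
  then obtain q where q: "\<And>w. poly (\<Prod>x\<leftarrow>xs. [:- x, 1:]) w = (w - z) ^ count_list xs z * poly q w"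
      "poly q z \<noteq> 0" by blast
  show ?case
  proof (cases "x = z")
    case True
    then show ?thesis
      using q by (intro exI[of _ q]) (auto simp: algebra_simps)
  next
    case False
    then show ?thesis
      using q by (intro exI[of _ "[:- x, 1:] * q"]) (auto simp: algebra_simps)
  qed
qed

lemma poly_prod_list_map: "poly (\<Prod>x\<leftarrow>xs. f x) s = (\<Prod>x\<leftarrow>xs. poly (f x) s)"
  by (induction xs) auto

lemma prod_lessThan_length: "(\<Prod>i<length xs. f (xs ! i)) = (\<Prod>x\<leftarrow>xs. f x)"
  using prod.list_conv_set_nth[of "map f xs"] by (simp add: lessThan_atLeast0)

lemma prod_list_divide: "(\<Prod>x\<leftarrow>xs. f x / g x) = (\<Prod>x\<leftarrow>xs. f x) / (\<Prod>x\<leftarrow>xs. g x :: 'a :: field)"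
  by (induction xs) auto

lemma norm_prod_list_map:
  fixes f :: "'a \<Rightarrow> 'b :: real_normed_field"
  shows "norm (\<Prod>x\<leftarrow>xs. f x) = (\<Prod>x\<leftarrow>xs. norm (f x))"
  by (induction xs) (auto simp: norm_mult)

lemma poly_map_of_real_cnj: "poly (map_poly of_real p) (cnj s) = cnj (poly (map_poly of_real p) s)"
  by (induction p) (auto simp: map_poly_pCons)

lemma poly_analytic: "poly r analytic_on X" for r :: "complex poly"
  by (induction r) (auto intro!: analytic_intros)

section \<open>The closed loop in quotient form\<close>

locale dead_time_loop =
  fixes P Q :: "real poly" and t\<^sub>d :: real and \<alpha>s \<beta>s :: "complex list"
  assumes P_nz: "P \<noteq> 0" and td: "t\<^sub>d \<ge> 0"
    and nondegenerate: "\<exists>s. poly (map_poly of_real P) s \<noteq> 0 \<and> 1 + dead_time_tf Q P t\<^sub>d s \<noteq> 0"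
    and zeros: "is_zero_list (sensitivity (dead_time_tf Q P t\<^sub>d)) open_rhp \<alpha>s"
    and poles: "is_pole_list (sensitivity (dead_time_tf Q P t\<^sub>d)) open_rhp \<beta>s"
begin

abbreviation "G \<equiv> dead_time_tf Q P t\<^sub>d"
abbreviation "p \<equiv> map_poly complex_of_real P"
abbreviation "g' \<equiv> modified_sensitivity G \<alpha>s \<beta>s"

text \<open>The characteristic quasi-polynomial, that is P (1 + G) with the denominator of G
  cleared. It is entire, so g becomes a quotient P/F of entire functions and the conventional values
  of G at zeros of P drop out.\<close>

definition F :: "complex \<Rightarrow> complex" where
  "F s = poly p s + poly (map_poly of_real Q) s * exp (- (of_real t\<^sub>d * s))"

definition a :: "complex poly" where
  "a = (\<Prod>x\<leftarrow>\<alpha>s. [:cnj x, 1:]) * (\<Prod>x\<leftarrow>\<beta>s. [:- x, 1:])"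

definition b :: "complex poly" where
  "b = (\<Prod>x\<leftarrow>\<alpha>s. [:- x, 1:]) * (\<Prod>x\<leftarrow>\<beta>s. [:cnj x, 1:])"

definition h :: "complex \<Rightarrow> complex" where
  "h s = poly p s * poly a s / (F s * poly b s)"

lemma kappa_eq: "kappa \<alpha>s \<beta>s s = poly a s / poly b s"
  unfolding kappa_def prod_lessThan_length[of "\<lambda>x. (s + cnj x) / (s - x)"]
    prod_lessThan_length[of "\<lambda>x. (s - x) / (s + cnj x)"]
  by (simp add: a_def b_def poly_prod_list_map prod_list_divide add.commute)

lemma F_holomorphic: "F holomorphic_on X"
  unfolding F_def by (intro holomorphic_intros)

lemma F_analytic: "F analytic_on X"
  using F_holomorphic[of UNIV] by (metis analytic_on_open analytic_on_subset open_UNIV subset_UNIV)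

lemma p_nz: "p \<noteq> 0"
  using P_nz by (simp add: map_poly_eq_0_iff)

lemma a_nz: "a \<noteq> 0" and b_nz: "b \<noteq> 0"
  by (auto simp: a_def b_def prod_list_zero_iff)

lemma eventually_nonzero:
  assumes "f holomorphic_on UNIV" "f w \<noteq> 0"
  shows "\<forall>\<^sub>F s in at z. f s \<noteq> 0"
  using non_zero_neighbour_alt[OF assms(1), of z w] assms by (auto elim: eventually_mono)

lemma eventually_poly_nonzero:
  fixes r :: "complex poly"
  assumes "r \<noteq> 0"
  shows "\<forall>\<^sub>F s in at z. poly r s \<noteq> 0"
proof -
  obtain w where "poly r w \<noteq> 0"
    using assms poly_all_0_iff_0 by blast
  then show ?thesis
    by (intro eventually_nonzero) (auto intro: holomorphic_intros)
qed

lemma F_eq: "poly p s \<noteq> 0 \<Longrightarrow> F s = poly p s * (1 + G s)"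
  by (simp add: F_def dead_time_tf_def field_simps)

lemma eventually_F_nonzero: "\<forall>\<^sub>F s in at z. F s \<noteq> 0"
proof -
  obtain w where "F w \<noteq> 0"
    using nondegenerate F_eq by (metis mult_eq_0_iff)
  then show ?thesis
    using F_holomorphic by (intro eventually_nonzero)
qed

lemma eventually_generic:
  "\<forall>\<^sub>F s in at z. poly p s \<noteq> 0 \<and> F s \<noteq> 0 \<and> poly a s \<noteq> 0 \<and> poly b s \<noteq> 0"
  using eventually_F_nonzero[of z] eventually_poly_nonzero[OF p_nz, of z]
    eventually_poly_nonzero[OF a_nz, of z] eventually_poly_nonzero[OF b_nz, of z]
  by eventually_elim auto

lemma G_analytic: "poly p s \<noteq> 0 \<Longrightarrow> G analytic_on {s}"
  unfolding dead_time_tf_def by (intro analytic_intros poly_analytic) auto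

lemma sensitivity_eq:
  assumes "poly p s \<noteq> 0" "F s \<noteq> 0"
  shows "sensitivity G s = poly p s / F s"
proof -
  have "(\<lambda>s. 1 / (1 + G s)) analytic_on {s}"
    using assms F_eq[OF assms(1)] by (intro analytic_intros G_analytic) auto
  then have "sensitivity G s = 1 / (1 + G s)"
    unfolding sensitivity_def by (rule remove_sings_at_analytic)
  then show ?thesis
    using assms F_eq[OF assms(1)] by simp
qed

lemma g'_eq: "g' z = remove_sings h z"
  unfolding modified_sensitivity_def
proof (rule remove_sings_cong)
  show "\<forall>\<^sub>F s in at z. sensitivity G s * kappa \<alpha>s \<beta>s s = h s"
    using eventually_generic[of z] by eventually_elim (simp add: sensitivity_eq kappa_eq h_def)
qed simp

lemma h_analytic: "F s \<noteq> 0 \<Longrightarrow> poly b s \<noteq> 0 \<Longrightarrow> h analytic_on {s}"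
  unfolding h_def by (intro analytic_intros F_analytic poly_analytic) auto

lemma g'_eq_h: "F s \<noteq> 0 \<Longrightarrow> poly b s \<noteq> 0 \<Longrightarrow> g' s = h s"
  using h_analytic by (simp add: g'_eq)

lemma h_meromorphic: "h meromorphic_on {z}"
  unfolding h_def
  by (intro meromorphic_intros analytic_on_imp_meromorphic_on F_analytic poly_analytic)

section \<open>The Blaschke factor and the cancellation of zeros and poles\<close>

lemma zeros_poles_rhp: "x \<in> set \<alpha>s \<union> set \<beta>s \<Longrightarrow> Re x > 0"
proof -
  assume "x \<in> set \<alpha>s \<union> set \<beta>s"
  then have "count_list \<alpha>s x \<noteq> 0 \<or> count_list \<beta>s x \<noteq> 0"
    by (auto simp: count_list_0_iff)
  then have "x \<in> open_rhp"
    using zeros poles unfolding is_zero_list_def is_pole_list_def by (metis of_nat_eq_0_iff)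
  then show ?thesis by (simp add: open_rhp_def)
qed

lemma reflected_nonzero:
  assumes "Re s \<ge> 0"
  shows "poly (\<Prod>x\<leftarrow>\<alpha>s. [:cnj x, 1:]) s \<noteq> 0" "poly (\<Prod>x\<leftarrow>\<beta>s. [:cnj x, 1:]) s \<noteq> 0"
proof -
  have ne: "s + cnj x \<noteq> 0" if "Re x > 0" for x
    using that assms by (auto simp: complex_eq_iff)
  have "poly (\<Prod>x\<leftarrow>xs. [:cnj x, 1:]) s \<noteq> 0" if "\<And>x. x \<in> set xs \<Longrightarrow> Re x > 0" for xs
    unfolding poly_prod_list_map using that
    by (induction xs) (use ne in \<open>auto simp: add.commute\<close>)
  then show "poly (\<Prod>x\<leftarrow>\<alpha>s. [:cnj x, 1:]) s \<noteq> 0" "poly (\<Prod>x\<leftarrow>\<beta>s. [:cnj x, 1:]) s \<noteq> 0"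
    using zeros_poles_rhp by blast+
qed

lemma axis_nonzero:
  assumes "Re s = 0"
  shows "poly a s \<noteq> 0" "poly b s \<noteq> 0"
  using assms zeros_poles_rhp[of s] reflected_nonzero[of s]
  by (auto simp: a_def b_def poly_prod_list_map[where f = "\<lambda>x. [:- x, 1:]"] prod_list_zero_iff)

text \<open>A point of the axis is equidistant from x and its mirror image -cnj x.\<close>

lemma norm_a_axis:
  assumes "Re s = 0"
  shows "cmod (poly a s) = cmod (poly b s)"
proof -
  have "cmod (s + cnj x) = cmod (s - x)" for x
    using assms by (simp add: cmod_def power2_eq_square algebra_simps)
  then show ?thesis
    by (simp add: a_def b_def poly_prod_list_map norm_mult norm_prod_list_map add.commute)
qed

text \<open>The order is positive at a zero, negative at a pole and 0 at any other point, since g is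
  not locally zero. At most one of the two counts is therefore nonzero, and their difference is the
  order in all three cases.\<close>

lemma zorder_sensitivity:
  assumes "Re z > 0"
  shows "zorder (\<lambda>s. poly p s / F s) z = int (count_list \<alpha>s z) - int (count_list \<beta>s z)"
proof -
  have ev: "\<forall>\<^sub>F s in at z. sensitivity G s = poly p s / F s"
    using eventually_generic[of z] by eventually_elim (simp add: sensitivity_eq)
  have mero: "(\<lambda>s. poly p s / F s) meromorphic_on {z}"
    by (intro meromorphic_intros analytic_on_imp_meromorphic_on F_analytic poly_analytic)
  then have mero': "sensitivity G meromorphic_on {z}"
    unfolding meromorphic_at_iff
    using isolated_singularity_at_cong[OF ev refl] not_essential_cong[OF ev refl] by simp
  have iso: "isolated_singularity_at (sensitivity G) z"
    using mero' meromorphic_at_iff by blast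
  have nz: "\<forall>\<^sub>F s in at z. sensitivity G s \<noteq> 0"
    using eventually_generic[of z] by eventually_elim (simp add: sensitivity_eq)
  have z: "z \<in> open_rhp"
    using assms by (simp add: open_rhp_def)
  have \<alpha>: "int (count_list \<alpha>s z) = (if isolated_zero (sensitivity G) z then zorder (sensitivity G) z else 0)"
    using zeros z by (simp add: is_zero_list_def)
  have \<beta>: "int (count_list \<beta>s z) = (if is_pole (sensitivity G) z then - zorder (sensitivity G) z else 0)"
    using poles z by (simp add: is_pole_list_def)
  have "zorder (\<lambda>s. poly p s / F s) z = zorder (sensitivity G) z"
    using ev by (intro zorder_cong) (auto elim: eventually_mono)
  also have "\<dots> = int (count_list \<alpha>s z) - int (count_list \<beta>s z)"
    using \<alpha> \<beta> zorder_isolated_zero_pos'[OF _ iso] isolated_pole_imp_neg_zorder[OF iso]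
      not_pole_not_isolated_zero_imp_zorder_eq_0[OF mero'] eventually_frequently[OF at_neq_bot nz]
    by (auto split: if_splits)
  finally show ?thesis .
qed

text \<open>Locally P/F is (w - z)^n times a nonvanishing function, with n the difference of the two
  multiplicities, and a/b contributes exactly (w - z)^(-n). This is where completeness of the lists
  enters.\<close>

lemma h_tendsto_rhp:
  assumes z: "Re z > 0"
  shows "\<exists>c. c \<noteq> 0 \<and> h \<midarrow>z\<rightarrow> c"
proof -
  define f where "f = (\<lambda>s. poly p s / F s)"
  define n where "n = zorder f z"
  define u where "u = zor_poly f z"
  have mero: "f meromorphic_on {z}"
    unfolding f_def by (intro meromorphic_intros analytic_on_imp_meromorphic_on F_analytic poly_analytic)
  have nz: "\<forall>\<^sub>F s in at z. f s \<noteq> 0"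
    using eventually_generic[of z] by eventually_elim (simp add: f_def)
  have "isolated_singularity_at f z" "not_essential f z"
    using mero meromorphic_at_iff by blast+
  from zorder_exist[OF this eventually_frequently[OF at_neq_bot nz]]
  obtain r where u: "u z \<noteq> 0" and r: "r > 0" "u holomorphic_on cball z r"
    and eq: "\<And>w. w \<in> cball z r - {z} \<Longrightarrow> f w = u w * (w - z) powi n"
    unfolding u_def n_def by blast
  obtain a1 where a1: "\<And>w. poly (\<Prod>x\<leftarrow>\<beta>s. [:- x, 1:]) w = (w - z) ^ count_list \<beta>s z * poly a1 w" "poly a1 z \<noteq> 0"
    using prod_list_linear_factor_out by blast
  obtain b1 where b1: "\<And>w. poly (\<Prod>x\<leftarrow>\<alpha>s. [:- x, 1:]) w = (w - z) ^ count_list \<alpha>s z * poly b1 w" "poly b1 z \<noteq> 0"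
    using prod_list_linear_factor_out by blast
  define A B where "A = (\<Prod>x\<leftarrow>\<alpha>s. [:cnj x, 1:])" and "B = (\<Prod>x\<leftarrow>\<beta>s. [:cnj x, 1:])"
  have AB: "poly A z \<noteq> 0" "poly B z \<noteq> 0"
    using reflected_nonzero[of z] z by (auto simp: A_def B_def)
  \<comment> \<open>This is \<open>h\<close> with the powers of w - z cancelled: it is continuous
    and nonzero at z.\<close>
  define H where "H = (\<lambda>w. u w * (poly A w * poly a1 w / (poly b1 w * poly B w)))"
  have "isCont u z"
    using holomorphic_on_imp_continuous_on[OF r(2)] r(1) by (intro continuous_on_interior) auto
  then have "isCont H z"
    unfolding H_def using a1(2) b1(2) AB by (intro continuous_intros) auto
  then have "H \<midarrow>z\<rightarrow> H z"
    by (simp add: isCont_def)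
  moreover have "\<forall>\<^sub>F w in at z. w \<in> cball z r - {z}"
    using eventually_at_ball[OF r(1), of z UNIV] eventually_neq_at_within[of z z UNIV]
    by eventually_elim auto
  then have "\<forall>\<^sub>F w in at z. H w = h w"
  proof eventually_elim
    case (elim w)
    have "h w = f w * (poly a w / poly b w)"
      by (simp add: h_def f_def)
    also have "\<dots> = u w * ((w - z) ^ count_list \<alpha>s z / (w - z) ^ count_list \<beta>s z) * (poly a w / poly b w)"
      using eq[OF elim] elim zorder_sensitivity[OF z]
      by (simp add: n_def f_def power_int_diff)
    also have "\<dots> = H w"
      using elim by (simp add: H_def a_def b_def a1 b1 A_def B_def)
    finally show ?case by simp
  qed
  ultimately have "h \<midarrow>z\<rightarrow> H z"
    by (rule Lim_transform_eventually)
  moreover have "H z \<noteq> 0"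
    using u a1(2) b1(2) AB by (simp add: H_def)
  ultimately show ?thesis by blast
qed

section \<open>Conjugate symmetry and regularity on the imaginary axis\<close>

lemma F_cnj: "F (cnj s) = cnj (F s)"
  by (simp add: F_def poly_map_of_real_cnj exp_cnj)

text \<open>On the axis |h| = |P/F|, and P and F commute with conjugation. Passing to P/F avoids
  having to show that the two lists are symmetric under conjugation.\<close>

lemma norm_h_axis:
  "cmod (h (\<i> * of_real (- y))) = cmod (h (\<i> * of_real y))"
proof -
  have cnj: "\<i> * of_real (- y) = cnj (\<i> * of_real y)"
    by simp
  have *: "cmod (h s) = cmod (poly p s) / cmod (F s)" if "Re s = 0" for s
    using norm_a_axis[OF that] axis_nonzero[OF that] by (simp add: h_def norm_divide norm_mult)
  show ?thesis
    unfolding cnj using *[of "\<i> * of_real y"] *[of "cnj (\<i> * of_real y)"]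
    by (simp only: F_cnj poly_map_of_real_cnj complex_mod_cnj) simp
qed

lemma eventually_axis:
  assumes "\<forall>\<^sub>F s in at (\<i> * of_real y). \<P> s"
  shows "\<forall>\<^sub>F t in at y. \<P> (\<i> * of_real t)"
proof -
  have "filterlim (\<lambda>t. \<i> * of_real t) (at (\<i> * of_real y)) (at y)"
    unfolding filterlim_at
    by (intro conjI tendsto_intros) (auto simp: eventually_at_filter)
  with assms show ?thesis
    by (rule eventually_compose_filterlim)
qed

text \<open>The bound says nothing at a pole itself, where \<open>remove_sings\<close> yields 0, but
  a pole would make |h| large at all nearby points of the axis. Those with negative ordinate are
  reflected by \<open>norm_h_axis\<close>. Being meromorphic and without a pole, \<open>h\<close>
  has a removable singularity.\<close>

lemma g'_analytic_axis:
  assumes bd: "\<And>y. y \<ge> 0 \<Longrightarrow> cmod (g' (\<i> * of_real y)) \<le> M" and z: "Re z = 0"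
  shows "g' analytic_on {z}"
proof -
  define y where "y = Im z"
  have zy: "z = \<i> * of_real y"
    using z by (simp add: y_def complex_eq_iff)
  have bd': "cmod (h (\<i> * of_real t)) \<le> M" if "F (\<i> * of_real t) \<noteq> 0" "F (\<i> * of_real (- t)) \<noteq> 0" for t
  proof -
    have "g' (\<i> * of_real \<bar>t\<bar>) = h (\<i> * of_real \<bar>t\<bar>)"
      using that by (intro g'_eq_h axis_nonzero) (auto simp: abs_if)
    moreover have "cmod (h (\<i> * of_real \<bar>t\<bar>)) = cmod (h (\<i> * of_real t))"
      using norm_h_axis[of t] by (simp add: abs_if)
    ultimately show ?thesis
      using bd[of "\<bar>t\<bar>"] by simp
  qed
  have "\<not> is_pole h z"
  proof
    assume "is_pole h z"
    then have "filterlim h at_infinity (at z)"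
      by (simp add: is_pole_def)
    then have "\<forall>\<^sub>F s in at z. cmod (h s) \<ge> \<bar>M\<bar> + 1"
      by (auto simp: filterlim_at_infinity[of 0])
    then have "\<forall>\<^sub>F t in at y. cmod (h (\<i> * of_real t)) \<ge> \<bar>M\<bar> + 1"
      unfolding zy by (rule eventually_axis)
    moreover have "\<forall>\<^sub>F t in at y. F (\<i> * of_real t) \<noteq> 0"
      by (rule eventually_axis) (rule eventually_F_nonzero)
    ultimately have "\<forall>\<^sub>F t in at y. False"
    proof eventually_elim
      case (elim t)
      have "F (\<i> * of_real (- t)) \<noteq> 0"
        using elim F_cnj[of "\<i> * of_real t"] by simp
      then show ?case
        using elim bd'[of t] by simp
    qed
    then show False
      by simp
  qed
  moreover have "isolated_singularity_at h z" "not_essential h z"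
    using h_meromorphic meromorphic_at_iff by blast+
  ultimately obtain c where "h \<midarrow>z\<rightarrow> c"
    by (auto simp: not_essential_def)
  then have "remove_sings h analytic_on {z}"
    by (intro remove_sings_analytic_at \<open>isolated_singularity_at h z\<close>)
  moreover have "g' = remove_sings h"
    using g'_eq by blast
  ultimately show ?thesis
    by simp
qed

lemma g'_analytic_rhp:
  assumes "Re z > 0"
  shows "g' analytic_on {z}" "g' z \<noteq> 0"
proof -
  obtain c where c: "c \<noteq> 0" "h \<midarrow>z\<rightarrow> c"
    using h_tendsto_rhp[OF assms] by blast
  have "isolated_singularity_at h z"
    using h_meromorphic meromorphic_at_iff by blast
  moreover have "g' = remove_sings h"
    using g'_eq by blast
  ultimately show "g' analytic_on {z}" "g' z \<noteq> 0"
    using c remove_sings_analytic_at remove_sings_eqI by auto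
qed

text \<open>The symmetry is inherited from \<open>h\<close> off the zeros of \<open>F\<close>;
  continuity of \<open>g'\<close> along the axis carries it to the remaining points.\<close>

lemma norm_g'_axis:
  assumes "\<And>z. Re z = 0 \<Longrightarrow> g' analytic_on {z}"
  shows "cmod (g' (\<i> * of_real (- y))) = cmod (g' (\<i> * of_real y))"
proof -
  have cont: "((\<lambda>t. g' (\<i> * of_real (k * t))) \<longlongrightarrow> g' (\<i> * of_real (k * y))) (at y)" for k :: real
  proof -
    have "isCont g' (\<i> * of_real (k * y))"
      using assms by (intro analytic_at_imp_isCont) auto
    then show ?thesis
      by (rule isCont_tendsto_compose) (intro tendsto_intros)
  qed
  have "\<forall>\<^sub>F t in at y. F (\<i> * of_real t) \<noteq> 0"
    by (rule eventually_axis) (rule eventually_F_nonzero)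
  then have "\<forall>\<^sub>F t in at y. cmod (g' (\<i> * of_real (- 1 * t))) = cmod (g' (\<i> * of_real (1 * t)))"
  proof eventually_elim
    case (elim t)
    have "F (\<i> * of_real (- t)) \<noteq> 0"
      using elim F_cnj[of "\<i> * of_real t"] by simp
    then have "g' (\<i> * of_real (- t)) = h (\<i> * of_real (- t))" "g' (\<i> * of_real t) = h (\<i> * of_real t)"
      using elim by (intro g'_eq_h axis_nonzero; simp)+
    then show ?case
      using norm_h_axis[of t] by simp
  qed
  then have "((\<lambda>t. cmod (g' (\<i> * of_real (- 1 * t)))) \<longlongrightarrow> cmod (g' (\<i> * of_real (1 * y)))) (at y)"
    using tendsto_norm[OF cont[of 1]] by (subst tendsto_cong) auto
  with tendsto_norm[OF cont[of "-1"]] show ?thesis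
    using tendsto_unique[OF at_neq_bot] by fastforce
qed

section \<open>Relations that survive at exceptional points\<close>

text \<open>Cleared of denominators, the defining relation extends by continuity to zeros of
  \<open>F\<close> and \<open>b\<close>, where \<open>h\<close> itself has only a conventional
  value.\<close>

lemma g'_identity:
  assumes "g' analytic_on {z}"
  shows "g' z * (F z * poly b z) = poly p z * poly a z"
proof (rule tendsto_unique[OF at_neq_bot])
  have "isCont (\<lambda>s. g' s * (F s * poly b s)) z"
    using assms F_analytic by (intro continuous_intros analytic_at_imp_isCont) auto
  then show "((\<lambda>s. g' s * (F s * poly b s)) \<longlongrightarrow> g' z * (F z * poly b z)) (at z)"
    by (simp add: isCont_def)
  have "\<forall>\<^sub>F s in at z. poly p s * poly a s = g' s * (F s * poly b s)"
    using eventually_generic[of z] by eventually_elim (simp add: g'_eq_h h_def)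
  moreover have "isCont (\<lambda>s. poly p s * poly a s) z"
    by (intro continuous_intros)
  then have "((\<lambda>s. poly p s * poly a s) \<longlongrightarrow> poly p z * poly a z) (at z)"
    by (simp add: isCont_def)
  ultimately show "((\<lambda>s. g' s * (F s * poly b s)) \<longlongrightarrow> poly p z * poly a z) (at z)"
    by (rule Lim_transform_eventually[rotated])
qed

text \<open>The relation g' (1 + G') = 1 is available only near \<sigma>, because the formulas for
  both factors may break down at \<sigma> itself; letting s tend to \<sigma> gives the
  value.\<close>

lemma g'_eq_1:
  assumes "Re \<sigma> > 0" "isolated_zero (modified_open_loop G \<alpha>s \<beta>s) \<sigma>"
  shows "g' \<sigma> = 1"
proof (rule tendsto_unique[OF at_neq_bot])
  let ?G' = "modified_open_loop G \<alpha>s \<beta>s"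
  have "?G' \<midarrow>\<sigma>\<rightarrow> 0"
    using assms by (simp add: isolated_zero_def)
  moreover have "g' \<midarrow>\<sigma>\<rightarrow> g' \<sigma>"
    using g'_analytic_rhp(1)[OF assms(1)] analytic_at_imp_isCont isContD by blast
  ultimately have "(\<lambda>s. g' s * (1 + ?G' s)) \<midarrow>\<sigma>\<rightarrow> g' \<sigma> * (1 + 0)"
    by (intro tendsto_intros)
  then show "(\<lambda>s. g' s * (1 + ?G' s)) \<midarrow>\<sigma>\<rightarrow> g' \<sigma>"
    by simp
  have "\<forall>\<^sub>F s in at \<sigma>. 1 = g' s * (1 + ?G' s)"
    using eventually_generic[of \<sigma>]
  proof eventually_elim
    case (elim s)
    have "(\<lambda>s. (1 - poly a s / poly b s + G s) / (poly a s / poly b s)) analytic_on {s}"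
      using elim by (intro analytic_intros G_analytic poly_analytic) auto
    then have G'_eq: "?G' s = (1 - poly a s / poly b s + G s) / (poly a s / poly b s)"
      unfolding modified_open_loop_def kappa_eq by (rule remove_sings_at_analytic)
    have cancel: "1 + (1 - k + G s) / k = (1 + G s) / k" if "k \<noteq> 0" for k
      using that by (simp add: field_simps)
    have "1 + ?G' s = (1 + G s) / (poly a s / poly b s)"
      unfolding G'_eq by (rule cancel) (use elim in simp)
    moreover have "g' s = 1 / (1 + G s) * (poly a s / poly b s)" "1 + G s \<noteq> 0"
      using elim F_eq[of s] by (auto simp: g'_eq_h h_def)
    ultimately show ?case
      using elim by simp
  qed
  then show "(\<lambda>s. g' s * (1 + ?G' s)) \<midarrow>\<sigma>\<rightarrow> 1"
    by (rule Lim_transform_eventually[OF tendsto_const])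
qed

section \<open>Size of the denominator and the estimate for the loop\<close>

lemma F_poly_bounded: "poly_bounded F"
proof -
  have "poly_bounded (\<lambda>s. exp (- (of_real t\<^sub>d * s)))"
    by (rule poly_bounded_bounded[where K = 1]) (use td in simp)
  then show ?thesis
    unfolding F_def by (intro poly_bounded_add poly_bounded_mult poly_bounded_poly)
qed

text \<open>With dead time, Q exp(-t_d x) tends to 0 and P dominates. Without it, leading terms of P
  and Q may cancel, but then \<open>F\<close> is the polynomial P + Q, and it is not the zero
  polynomial.\<close>

lemma F_bounded_below: "\<exists>c>0. \<forall>\<^sub>F x::real in at_top. cmod (F (of_real x)) \<ge> c"
proof (cases "t\<^sub>d = 0")
  case True
  define r where "r = p + map_poly of_real Q"
  have r: "F s = poly r s" for s
    unfolding F_def r_def using True by simp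
  have "r \<noteq> 0"
    using nondegenerate F_eq r by force
  then obtain c R where "c > 0" "\<And>s. cmod s \<ge> R \<Longrightarrow> cmod (poly r s) \<ge> c"
    using poly_bounded_below by blast
  then show ?thesis
    unfolding r by (intro exI[of _ c] conjI eventually_mono[OF eventually_ge_at_top[of R]]) auto
next
  case False
  with td have td': "t\<^sub>d > 0" by simp
  obtain c R where c: "c > 0" "\<And>s. cmod s \<ge> R \<Longrightarrow> cmod (poly p s) \<ge> c"
    using poly_bounded_below[OF p_nz] by blast
  obtain K n where K: "K \<ge> 0"
      "\<And>s. Re s \<ge> 0 \<Longrightarrow> cmod (poly (map_poly of_real Q) s) \<le> K * cmod (1 + s) ^ n"
    using poly_bounded_poly[of "map_poly of_real Q"] by (auto simp: poly_bounded_def)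
  have "((\<lambda>x::real. K * (1 + x) ^ n * exp (- (t\<^sub>d * x))) \<longlongrightarrow> 0) at_top"
    using td' by real_asymp
  then have "\<forall>\<^sub>F x in at_top. K * (1 + x) ^ n * exp (- (t\<^sub>d * x)) < c / 2"
    by (rule order_tendstoD) (use c in simp)
  with eventually_ge_at_top[of R] eventually_ge_at_top[of 0]
  have "\<forall>\<^sub>F x::real in at_top. cmod (F (of_real x)) \<ge> c / 2"
  proof eventually_elim
    case (elim x)
    from cmod_one_plus_of_real[OF elim(2)] have "cmod (poly (map_poly of_real Q) (of_real x) * exp (- (of_real t\<^sub>d * of_real x))) \<le> c / 2"
      using K(2)[of "of_real x"] elim
      by (simp add: norm_mult) (smt (verit) mult_right_mono exp_ge_zero)
    moreover have "cmod (poly p (of_real x)) \<ge> c"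
      using c(2)[of "of_real x"] elim by simp
    ultimately show ?case
      unfolding F_def
      using norm_diff_ineq[of "poly p (of_real x)" "poly (map_poly of_real Q) (of_real x) * exp (- (of_real t\<^sub>d * of_real x))"]
      by linarith
  qed
  with c show ?thesis
    by (intro exI[of _ "c / 2"]) auto
qed

text \<open>Here \<rho> is any positive bound on the segment, not the maximum, which leaves room for
  a vanishing maximum. Boundedness of \<open>g'\<close>, presupposed by
  \<open>two_constants_half_plane\<close>, is supplied by
  \<open>bounded_by_axis_bound\<close>.\<close>

lemma two_constants_bound:
  assumes w: "w > 0" and \<rho>: "0 < \<rho>" "\<rho> \<le> S"
    and inner: "\<And>y. 0 \<le> y \<Longrightarrow> y \<le> w \<Longrightarrow> cmod (g' (\<i> * of_real y)) \<le> \<rho>"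
    and outer: "\<And>y. y > w \<Longrightarrow> cmod (g' (\<i> * of_real y)) \<le> S"
    and x: "x > 0"
  shows "pi / 2 * ln (cmod (g' (of_real x))) \<le>
           arctan (w / x) * ln \<rho> + (pi / 2 - arctan (w / x)) * ln S"
proof -
  have "cmod (g' (\<i> * of_real y)) \<le> S" if "y \<ge> 0" for y
    using inner[of y] outer[of y] \<rho> that by linarith
  note axis_an = g'_analytic_axis[OF this]
  have an: "g' analytic_on {s}" if "Re s \<ge> 0" for s
    using that axis_an[of s] g'_analytic_rhp[of s] by linarith
  then have an': "g' analytic_on {s. Re s \<ge> 0}"
    by (auto intro: analytic_on_analytic_at[THEN iffD2])
  then have cont: "continuous_on {s. Re s \<ge> 0} g'"
    by (intro holomorphic_on_imp_continuous_on analytic_imp_holomorphic)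
  have hol: "g' holomorphic_on open_rhp"
    using analytic_imp_holomorphic[OF an'] by (rule holomorphic_on_subset) (auto simp: open_rhp_def)
  have sym: "cmod (g' (\<i> * of_real y)) = cmod (g' (\<i> * of_real \<bar>y\<bar>))" for y
    using norm_g'_axis[OF axis_an, of y] by (simp add: abs_if)
  have inner': "cmod (g' (\<i> * of_real y)) \<le> \<rho>" if "\<bar>y\<bar> \<le> w" for y
    unfolding sym[of y] using inner[of "\<bar>y\<bar>"] that by simp
  have outer': "cmod (g' (\<i> * of_real y)) \<le> S" if "\<bar>y\<bar> > w" for y
    unfolding sym[of y] using outer[of "\<bar>y\<bar>"] that by simp
  have axis: "cmod (g' s) \<le> S" if "Re s = 0" for s
  proof -
    have "s = \<i> * of_real (Im s)"
      using that by (simp add: complex_eq_iff)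
    then show ?thesis
      using inner'[of "Im s"] outer'[of "Im s"] \<rho> by (metis linorder_not_less order_trans)
  qed
  obtain c where c: "c > 0" "\<forall>\<^sub>F x::real in at_top. cmod (F (of_real x)) \<ge> c"
    using F_bounded_below by blast
  have bd: "cmod (g' s) \<le> S" if "Re s > 0" for s
    by (rule bounded_by_axis_bound[OF hol cont g'_analytic_rhp(2) _ F_poly_bounded c p_nz a_nz
          axis_nonzero(1) b_nz g'_identity[OF an] axis that])
       (auto intro: holomorphic_on_imp_continuous_on[OF F_holomorphic])
  show ?thesis
    using two_constants_half_plane[OF hol cont bd w \<rho>(1) _ inner' outer' x] g'_analytic_rhp(2)[of "of_real x"] \<rho> x
    by simp
qed

end

theorem theorem4:
  fixes P Q :: "real poly" and t\<^sub>d :: real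
    and G g g' G' :: "complex \<Rightarrow> complex"
    and \<alpha>s \<beta>s :: "complex list"
    and \<omega>\<^sub>c \<rho> s\<^sub>m\<^sub>a\<^sub>x :: real
  defines "G \<equiv> dead_time_tf Q P t\<^sub>d"
    and "g \<equiv> sensitivity G"
    and "g' \<equiv> modified_sensitivity G \<alpha>s \<beta>s"
    and "G' \<equiv> modified_open_loop G \<alpha>s \<beta>s"
  assumes "P \<noteq> 0" and "t\<^sub>d \<ge> 0"
    and "\<exists>s. poly (map_poly of_real P) s \<noteq> 0 \<and> 1 + G s \<noteq> 0"
    and "\<not> g analytic_on open_rhp"
    and "is_zero_list g open_rhp \<alpha>s"
    and "is_pole_list g open_rhp \<beta>s"
    and "\<omega>\<^sub>c > 0"
    and "is_max_on \<rho> (\<lambda>\<omega>. cmod (g' (\<i> * of_real \<omega>))) {0..\<omega>\<^sub>c}"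
    and "0 \<le> \<rho>" and "\<rho> < 1"
    and "is_max_on s\<^sub>m\<^sub>a\<^sub>x (\<lambda>\<omega>. cmod (g' (\<i> * of_real \<omega>))) {\<omega>\<^sub>c<..}"
    and "1 \<le> s\<^sub>m\<^sub>a\<^sub>x"
  shows "(\<forall>\<sigma>>0. - ln (cmod (g' (of_real \<sigma>))) < 0 \<longrightarrow>
            ln s\<^sub>m\<^sub>a\<^sub>x \<ge> \<bar>pi / 2 * ln (cmod (g' (of_real \<sigma>))) - arctan (\<omega>\<^sub>c / \<sigma>) * ln \<rho>\<bar>
                        / (pi / 2 - arctan (\<omega>\<^sub>c / \<sigma>))) \<and>
         (\<forall>\<sigma>>0. isolated_zero G' (of_real \<sigma>) \<longrightarrow>
            ln s\<^sub>m\<^sub>a\<^sub>x \<ge> \<bar>arctan (\<omega>\<^sub>c / \<sigma>) * ln \<rho>\<bar> / (pi / 2 - arctan (\<omega>\<^sub>c / \<sigma>)))"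
proof -
  interpret dead_time_loop P Q t\<^sub>d \<alpha>s \<beta>s
    using assms unfolding G_def g_def by unfold_locales auto
  have inner: "cmod (g' (\<i> * of_real y)) \<le> \<rho>" if "0 \<le> y" "y \<le> \<omega>\<^sub>c" for y
    using assms(12) that by (auto simp: is_max_on_def)
  have outer: "cmod (g' (\<i> * of_real y)) \<le> s\<^sub>m\<^sub>a\<^sub>x" if "y > \<omega>\<^sub>c" for y
    using assms(15) that by (auto simp: is_max_on_def)
  \<comment> \<open>The free parameter r replaces \<rho>, so that the case \<rho> = 0 can be reached
    through positive values.\<close>
  have bound: "pi / 2 * ln (cmod (g' (of_real \<sigma>))) \<le>
      arctan (\<omega>\<^sub>c / \<sigma>) * ln r + (pi / 2 - arctan (\<omega>\<^sub>c / \<sigma>)) * ln s\<^sub>m\<^sub>a\<^sub>x"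
    if "\<sigma> > 0" "r > 0" "\<rho> \<le> r" "r \<le> 1" for \<sigma> r
    unfolding g'_def G_def
    by (rule two_constants_bound)
       (use that assms inner outer in \<open>auto simp: g'_def G_def intro: order_trans\<close>)
  have pos: "pi / 2 - arctan (\<omega>\<^sub>c / \<sigma>) > 0" for \<sigma>
    using arctan_ubound by simp
  show ?thesis
  proof (intro conjI allI impI)
    fix \<sigma> :: real
    assume \<sigma>: "\<sigma> > 0" and "- ln (cmod (g' (of_real \<sigma>))) < 0"
    then have L: "pi / 2 * ln (cmod (g' (of_real \<sigma>))) > 0"
      by simp
    define \<theta> where "\<theta> = arctan (\<omega>\<^sub>c / \<sigma>)"
    have \<theta>: "\<theta> > 0"
      using \<sigma> \<open>\<omega>\<^sub>c > 0\<close> by (simp add: \<theta>_def)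
    have lnS: "ln s\<^sub>m\<^sub>a\<^sub>x \<ge> 0"
      using \<open>1 \<le> s\<^sub>m\<^sub>a\<^sub>x\<close> by simp
    \<comment> \<open>Since \<open>ln 0 = 0\<close>, this must be settled before ln \<rho> means
      anything. If the maximum were 0, every r in (0,1] would be allowed in \<open>bound\<close>,
      and small r contradict log |g'(\<sigma>)| > 0.\<close>
    have "\<rho> > 0"
    proof (rule ccontr)
      assume "\<not> ?thesis"
      then have \<rho>: "\<rho> = 0"
        using \<open>0 \<le> \<rho>\<close> by simp
      \<comment> \<open>Chosen so that r = exp(-N) makes the right-hand side of \<open>bound\<close>
        exactly 0.\<close>
      define N where "N = (pi / 2 - \<theta>) * ln s\<^sub>m\<^sub>a\<^sub>x / \<theta>"
      have "N \<ge> 0"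
        using pos[of \<sigma>] \<theta> lnS by (simp add: N_def \<theta>_def)
      then have "pi / 2 * ln (cmod (g' (of_real \<sigma>))) \<le> \<theta> * ln (exp (- N)) + (pi / 2 - \<theta>) * ln s\<^sub>m\<^sub>a\<^sub>x"
        unfolding \<theta>_def using \<sigma> \<rho> by (intro bound) auto
      also have "\<dots> = 0"
        using \<theta> by (simp add: N_def)
      finally show False
        using L by simp
    qed
    then have le: "pi / 2 * ln (cmod (g' (of_real \<sigma>))) \<le> \<theta> * ln \<rho> + (pi / 2 - \<theta>) * ln s\<^sub>m\<^sub>a\<^sub>x"
      unfolding \<theta>_def using \<sigma> \<open>\<rho> < 1\<close> by (intro bound) auto
    \<comment> \<open>Together with \<open>L\<close> this makes the expression inside the absolute
      value positive, so \<open>le\<close> is already the claim up to division.\<close>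
    have "\<theta> * ln \<rho> \<le> 0"
      using \<theta> \<open>\<rho> > 0\<close> \<open>\<rho> < 1\<close> by (simp add: mult_nonneg_nonpos)
    with le L have "\<bar>pi / 2 * ln (cmod (g' (of_real \<sigma>))) - \<theta> * ln \<rho>\<bar> \<le> (pi / 2 - \<theta>) * ln s\<^sub>m\<^sub>a\<^sub>x"
      by linarith
    then show "ln s\<^sub>m\<^sub>a\<^sub>x \<ge> \<bar>pi / 2 * ln (cmod (g' (of_real \<sigma>))) - arctan (\<omega>\<^sub>c / \<sigma>) * ln \<rho>\<bar>
        / (pi / 2 - arctan (\<omega>\<^sub>c / \<sigma>))"
      using pos[of \<sigma>] unfolding \<theta>_def by (simp only: pos_divide_le_eq mult.commute)
  next
    fix \<sigma> :: real
    assume \<sigma>: "\<sigma> > 0" and iso: "isolated_zero G' (of_real \<sigma>)"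
    show "ln s\<^sub>m\<^sub>a\<^sub>x \<ge> \<bar>arctan (\<omega>\<^sub>c / \<sigma>) * ln \<rho>\<bar> / (pi / 2 - arctan (\<omega>\<^sub>c / \<sigma>))"
    proof (cases "\<rho> = 0")
      case True
      \<comment> \<open>With \<open>ln 0 = 0\<close> the right-hand side is 0, and ln of the maximum
        outside the segment is nonnegative.\<close>
      then show ?thesis
        using \<open>1 \<le> s\<^sub>m\<^sub>a\<^sub>x\<close> by simp
    next
      case False
      then have \<rho>: "\<rho> > 0"
        using \<open>0 \<le> \<rho>\<close> by simp
      have "g' (of_real \<sigma>) = 1"
        using iso g'_eq_1[of "of_real \<sigma>"] \<sigma> by (simp add: g'_def G'_def G_def)
      \<comment> \<open>The left-hand side of \<open>bound\<close> vanishes because ln 1 =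
        0.\<close>
      then have "0 \<le> arctan (\<omega>\<^sub>c / \<sigma>) * ln \<rho> + (pi / 2 - arctan (\<omega>\<^sub>c / \<sigma>)) * ln s\<^sub>m\<^sub>a\<^sub>x"
        using bound[OF \<sigma> \<rho> order_refl] \<open>\<rho> < 1\<close> by simp
      moreover have "arctan (\<omega>\<^sub>c / \<sigma>) * ln \<rho> \<le> 0"
        using \<sigma> \<open>\<omega>\<^sub>c > 0\<close> \<rho> \<open>\<rho> < 1\<close> by (intro mult_nonneg_nonpos) auto
      ultimately have "\<bar>arctan (\<omega>\<^sub>c / \<sigma>) * ln \<rho>\<bar> \<le> (pi / 2 - arctan (\<omega>\<^sub>c / \<sigma>)) * ln s\<^sub>m\<^sub>a\<^sub>x"
        by linarith
      then show ?thesis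
        using pos[of \<sigma>] by (simp only: pos_divide_le_eq mult.commute)
    qed
  qed
qed

end
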